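(* Let $K$ be a field and let $S\subset Y=\prod_{i=1}^k\mathbb{P}^{n_i}$, with $n_i>0$ for all $i$, be a nondegenerate circuit with $\#(S)=4$. Let $\nu:Y\to\mathbb{P}^r$ be the Segre embedding and $X=\nu(Y)$. Then either $k=1$ and $n_1=2$, or $k=2$ and $n_1=n_2=1$. Assume $k=2$. Then $S$ is contained in a unique $D\in|\mathcal{O}_Y(1,1)|$, and: (a) If $D$ is reducible, say $D=D_1\cup D_2$ with $D_1\in|\mathcal{O}_Y(1,0)|$ and $D_2\in|\mathcal{O}_Y(0,1)|$, then $\#(S\cap D_1)=\#(S\cap D_2)=2$ and $D_1\cap D_2\cap S=\emptyset$. For any choice of $A\subset S$ with $\#(A\cap D_1)=\#(A\cap D_2)=1$, the set $\langle\nu(A)\rangle\cap\langle\nu(S\setminus A)\rangle$ is a single point $q$, and we have $r_X(q)=2$ and $A,\,S\setminus A\in\mathcal{S}(Y,q)$. (b) If $D$ is irreducible, then for any choice of $A\subset S$ with $\#(A)=2$ the set $\langle\nu(A)\rangle\cap\langle\nu(S\setminus A)\rangle$ is a single point $q$, and we have $r_X(q)=2$ and $A,\,S\setminus A\in\mathcal{S}(Y,q)$.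
   Context: Finite subsets of $Y$ consist of points defined over $K$. Here $r=-1+\prod_{i=1}^k(n_i+1)$, $\pi_i:Y\to\mathbb{P}^{n_i}$ is the projection onto the $i$-th factor, and $\langle\ \rangle$ denotes linear span. A finite set $S\subset Y$ is nondegenerate if $\langle\pi_i(S)\rangle=\mathbb{P}^{n_i}$ for all $i$, i.e. if $S$ is not contained in any proper multiprojective subspace of $Y$ (a product of linear subspaces of the factors, not equal to $Y$). $S$ is linearly independent (resp. dependent) if $\nu(S)\subset\mathbb{P}^r$ is linearly independent (resp. dependent). $S$ is a circuit if it is linearly dependent but every proper subset of it is linearly independent. For $q\in\mathbb{P}^r$, the $X$-rank $r_X(q)$ is the minimal cardinality of a finite subset of $X$ whose linear span contains $q$; $\mathcal{S}(Y,q)$ is the set of all $A\subset Y$ such that $\#(A)=r_X(q)$ and $q\in\langle\nu(A)\rangle$. *)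

theory Defs
  imports
    Complex_Main
    "HOL-Library.Function_Algebras"
    "HOL-Library.FuncSet"
    "HOL-Library.Poly_Mapping"
    "HOL-Computational_Algebra.Factorial_Ring"
begin

section \<open>Projective spaces over a field\<close>

text \<open>
  Coordinate vectors indexed by \<open>I\<close> are functions vanishing outside \<open>I\<close>. They live in the
  vector space of all functions on the index type, with pointwise operations.
\<close>

global_interpretation vec:
  vector_space "\<lambda>(c :: 'a :: field) (v :: 'i \<Rightarrow> 'a) x. c * v x"
  by unfold_locales (auto simp: fun_eq_iff algebra_simps)

definition coord_space :: "'i set \<Rightarrow> ('i \<Rightarrow> 'a :: field) set" where
  "coord_space I = {v. \<forall>x. x \<notin> I \<longrightarrow> v x = 0}"

text \<open>
  A rational point of a projective space is a one-dimensional subspace; \<open>hpoint v\<close> is the point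
  with homogeneous coordinates \<open>v\<close>, and \<open>proj_of W\<close> is the projectivization of \<open>W\<close>.
\<close>

definition hpoint :: "('i \<Rightarrow> 'a :: field) \<Rightarrow> ('i \<Rightarrow> 'a) set" where
  "hpoint v = vec.span {v}"

definition proj_of :: "('i \<Rightarrow> 'a :: field) set \<Rightarrow> ('i \<Rightarrow> 'a) set set" where
  "proj_of W = hpoint ` (W - {0})"

definition proj_space :: "nat \<Rightarrow> (nat \<Rightarrow> 'a :: field) set set" where
  "proj_space m = proj_of (coord_space {0..m})"

definition proj_span :: "('i \<Rightarrow> 'a :: field) set set \<Rightarrow> ('i \<Rightarrow> 'a) set set" where
  "proj_span A = proj_of (vec.span (\<Union>A))"

text \<open>
  Independent vectors have pairwise distinct spans, so \<open>hpoint\<close> is injective on the set \<open>B\<close> below.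
\<close>

definition proj_independent :: "('i \<Rightarrow> 'a :: field) set set \<Rightarrow> bool" where
  "proj_independent A \<longleftrightarrow> (\<exists>B. vec.independent B \<and> A = hpoint ` B)"


section \<open>Multiprojective spaces and the Segre embedding\<close>

definition multiproj ::
  "nat \<Rightarrow> (nat \<Rightarrow> nat) \<Rightarrow> (nat \<Rightarrow> (nat \<Rightarrow> 'a :: field) set) set" where
  "multiproj k n = (\<Pi>\<^sub>E i\<in>{1..k}. proj_space (n i))"

text \<open>
  The target \<open>\<P>\<^sup>r\<close> of the Segre embedding has one homogeneous coordinate for each
  multi-index \<open>J\<close> with \<open>J i \<in> {0..n i}\<close>; no enumeration of the multi-indices is chosen.
\<close>

definition multi_indices :: "nat \<Rightarrow> (nat \<Rightarrow> nat) \<Rightarrow> (nat \<Rightarrow> nat) set" where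
  "multi_indices k n = (\<Pi>\<^sub>E i\<in>{1..k}. {0..n i})"

lemma card_multi_indices: "card (multi_indices k n) = (\<Prod>i\<in>{1..k}. n i + 1)"
  by (simp add: multi_indices_def card_PiE)

definition segre_target :: "nat \<Rightarrow> (nat \<Rightarrow> nat) \<Rightarrow> ((nat \<Rightarrow> nat) \<Rightarrow> 'a :: field) set set" where
  "segre_target k n = proj_of (coord_space (multi_indices k n))"

definition segre_coords ::
  "nat \<Rightarrow> (nat \<Rightarrow> nat) \<Rightarrow> (nat \<Rightarrow> nat \<Rightarrow> 'a :: field) \<Rightarrow> (nat \<Rightarrow> nat) \<Rightarrow> 'a" where
  "segre_coords k n v = (\<lambda>J. if J \<in> multi_indices k n then \<Prod>i\<in>{1..k}. v i (J i) else 0)"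

text \<open>Taking the span over all representatives \<open>v\<close> of \<open>y\<close> avoids choosing one.\<close>

definition segre ::
  "nat \<Rightarrow> (nat \<Rightarrow> nat) \<Rightarrow> (nat \<Rightarrow> (nat \<Rightarrow> 'a :: field) set) \<Rightarrow> ((nat \<Rightarrow> nat) \<Rightarrow> 'a) set" where
  "segre k n y = vec.span {segre_coords k n v | v. \<forall>i\<in>{1..k}. v i \<in> y i}"

lemma segre_hpoint:
  assumes "\<forall>i\<in>{1..k}. y i = hpoint (w i)"
  shows "segre k n y = hpoint (segre_coords k n w)"
proof -
  have "segre_coords k n v \<in> vec.span {segre_coords k n w}"
    if v: "\<forall>i\<in>{1..k}. v i \<in> y i" for v
  proof -
    have "\<exists>c. v i = (\<lambda>x. c * w i x)" if "i \<in> {1..k}" for i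
      using v assms that by (auto simp: hpoint_def vec.span_singleton)
    then obtain c where c: "\<And>i. i \<in> {1..k} \<Longrightarrow> v i = (\<lambda>x. c i * w i x)"
      by metis
    have "segre_coords k n v = (\<lambda>J. (\<Prod>i\<in>{1..k}. c i) * segre_coords k n w J)"
      by (rule ext) (simp add: segre_coords_def c flip: prod.distrib)
    then show ?thesis by (auto simp: vec.span_singleton)
  qed
  then have "segre k n y \<subseteq> hpoint (segre_coords k n w)"
    unfolding segre_def hpoint_def
    by (intro vec.span_minimal vec.subspace_span) auto
  moreover have "\<forall>i\<in>{1..k}. w i \<in> y i"
    using assms by (auto simp: hpoint_def vec.span_base)
  then have "hpoint (segre_coords k n w) \<subseteq> segre k n y"
    unfolding segre_def hpoint_def by (intro vec.span_mono) auto
  ultimately show ?thesis by (rule subset_antisym)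
qed

lemma segre_in_target:
  assumes "y \<in> multiproj k n"
  shows "segre k n y \<in> segre_target k n"
proof -
  have "\<forall>i\<in>{1..k}. \<exists>u. u \<in> coord_space {0..n i} \<and> u \<noteq> 0 \<and> y i = hpoint u"
    using assms by (auto simp: multiproj_def proj_space_def proj_of_def dest!: PiE_mem)
  then obtain w where w: "\<forall>i\<in>{1..k}. w i \<in> coord_space {0..n i} \<and> w i \<noteq> 0 \<and> y i = hpoint (w i)"
    by (rule bchoice[THEN exE])
  have "\<exists>j. j \<in> {0..n i} \<and> w i j \<noteq> 0" if i: "i \<in> {1..k}" for i
  proof -
    have "w i \<in> coord_space {0..n i}" "w i \<noteq> 0" using w i by auto
    then show ?thesis by (force simp: coord_space_def fun_eq_iff)
  qed
  then obtain j where j: "\<forall>i\<in>{1..k}. j i \<in> {0..n i} \<and> w i (j i) \<noteq> 0"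
    using bchoice[of "{1..k}" "\<lambda>i j. j \<in> {0..n i} \<and> w i j \<noteq> 0"] by blast
  have "restrict j {1..k} \<in> multi_indices k n"
    using j by (auto simp: multi_indices_def)
  then have "segre_coords k n w (restrict j {1..k}) \<noteq> 0"
    using j by (simp add: segre_coords_def)
  then have "segre_coords k n w \<noteq> 0"
    by (auto simp: fun_eq_iff)
  moreover have "segre_coords k n w \<in> coord_space (multi_indices k n)"
    by (simp add: coord_space_def segre_coords_def)
  ultimately show ?thesis
    using segre_hpoint[of k y w n] w by (auto simp: segre_target_def proj_of_def)
qed

definition segre_variety ::
  "nat \<Rightarrow> (nat \<Rightarrow> nat) \<Rightarrow> ((nat \<Rightarrow> nat) \<Rightarrow> 'a :: field) set set" where
  "segre_variety k n = segre k n ` multiproj k n"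

definition nondegenerate ::
  "nat \<Rightarrow> (nat \<Rightarrow> nat) \<Rightarrow> (nat \<Rightarrow> (nat \<Rightarrow> 'a :: field) set) set \<Rightarrow> bool" where
  "nondegenerate k n S \<longleftrightarrow> (\<forall>i\<in>{1..k}. proj_span ((\<lambda>y. y i) ` S) = proj_space (n i))"

definition segre_independent ::
  "nat \<Rightarrow> (nat \<Rightarrow> nat) \<Rightarrow> (nat \<Rightarrow> (nat \<Rightarrow> 'a :: field) set) set \<Rightarrow> bool" where
  "segre_independent k n S \<longleftrightarrow> proj_independent (segre k n ` S)"

definition circuit ::
  "nat \<Rightarrow> (nat \<Rightarrow> nat) \<Rightarrow> (nat \<Rightarrow> (nat \<Rightarrow> 'a :: field) set) set \<Rightarrow> bool" where
  "circuit k n S \<longleftrightarrow>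
     \<not> segre_independent k n S \<and> (\<forall>T. T \<subset> S \<longrightarrow> segre_independent k n T)"

definition X_rank ::
  "nat \<Rightarrow> (nat \<Rightarrow> nat) \<Rightarrow> ((nat \<Rightarrow> nat) \<Rightarrow> 'a :: field) set \<Rightarrow> nat" where
  "X_rank k n q =
     (LEAST m. \<exists>B \<subseteq> segre_variety k n. finite B \<and> card B = m \<and> q \<in> proj_span B)"

definition rank_sets ::
  "nat \<Rightarrow> (nat \<Rightarrow> nat) \<Rightarrow> ((nat \<Rightarrow> nat) \<Rightarrow> 'a :: field) set \<Rightarrow>
     (nat \<Rightarrow> (nat \<Rightarrow> 'a) set) set set" where
  "rank_sets k n q =
     {A. A \<subseteq> multiproj k n \<and> finite A \<and> card A = X_rank k n q \<and> q \<in> proj_span (segre k n ` A)}"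


section \<open>Effective divisors on multiprojective spaces\<close>

text \<open>
  The variable \<open>(i, j)\<close> stands for the \<open>j\<close>-th homogeneous coordinate on the \<open>i\<close>-th factor;
  a monomial is its finitely supported exponent function.
\<close>

type_synonym 'a mpoly = "((nat \<times> nat) \<Rightarrow>\<^sub>0 nat) \<Rightarrow>\<^sub>0 'a"

definition multihomogeneous ::
  "nat \<Rightarrow> (nat \<Rightarrow> nat) \<Rightarrow> (nat \<Rightarrow> nat) \<Rightarrow> 'a :: field mpoly \<Rightarrow> bool" where
  "multihomogeneous k n d f \<longleftrightarrow>
     (\<forall>m \<in> Poly_Mapping.keys f.
        Poly_Mapping.keys m \<subseteq> (SIGMA i:{1..k}. {0..n i}) \<and>
        (\<forall>i\<in>{1..k}. (\<Sum>j\<in>{0..n i}. Poly_Mapping.lookup m (i, j)) = d i))"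

definition mpoly_eval :: "'a :: field mpoly \<Rightarrow> (nat \<Rightarrow> nat \<Rightarrow> 'a) \<Rightarrow> 'a" where
  "mpoly_eval f v =
     (\<Sum>m \<in> Poly_Mapping.keys f. Poly_Mapping.lookup f m *
        (\<Prod>(i, j) \<in> Poly_Mapping.keys m. v i j ^ Poly_Mapping.lookup m (i, j)))"

text \<open>
  An effective divisor is the class of its equations, which are unique up to nonzero scalars.
  Over a small field its set of rational points would not determine it. The linear system of
  multidegree \<open>d\<close>, i.e. \<open>|\<O>(d\<^sub>1, \<dots>, d\<^sub>k)|\<close>, is the set of classes of nonzero forms of
  multidegree \<open>d\<close>.
\<close>

definition divisor_of :: "'a :: field mpoly \<Rightarrow> 'a mpoly set" where
  "divisor_of f = {Poly_Mapping.single 0 c * f | c. c \<noteq> 0}"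

definition linear_system ::
  "nat \<Rightarrow> (nat \<Rightarrow> nat) \<Rightarrow> (nat \<Rightarrow> nat) \<Rightarrow> 'a :: field mpoly set set" where
  "linear_system k n d = {divisor_of f | f. multihomogeneous k n d f \<and> f \<noteq> 0}"

definition divisor_points ::
  "nat \<Rightarrow> (nat \<Rightarrow> nat) \<Rightarrow> 'a :: field mpoly set \<Rightarrow> (nat \<Rightarrow> (nat \<Rightarrow> 'a) set) set" where
  "divisor_points k n D =
     {y \<in> multiproj k n. \<forall>f\<in>D. \<forall>v. (\<forall>i\<in>{1..k}. v i \<in> y i - {0}) \<longrightarrow> mpoly_eval f v = 0}"

text \<open>The union of two divisors (with multiplicities) is cut out by products of equations.\<close>

definition divisor_union :: "'a :: field mpoly set \<Rightarrow> 'a mpoly set \<Rightarrow> 'a mpoly set" where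
  "divisor_union D E = {f * g | f g. f \<in> D \<and> g \<in> E}"

definition irreducible_divisor :: "'a :: field mpoly set \<Rightarrow> bool" where
  "irreducible_divisor D \<longleftrightarrow> (\<forall>f\<in>D. irreducible f)"

definition bidegree :: "nat \<Rightarrow> nat \<Rightarrow> nat \<Rightarrow> nat" where
  "bidegree a b = (\<lambda>_. 0)(1 := a, 2 := b)"

end

theory Submission
  imports Defs "HOL-Library.Product_Lexorder"
begin

text \<open>
  A circuit gives a linear relation between the tensors of its points with all coefficients
  nonzero. Applying a product of linear forms, one on each factor, to this relation shows: however
  the points other than \<open>a\<close> are distributed over the factors, on some factor \<open>a\<close> lies in the span
  of the points assigned to it. For four points this bounds the dimensions and
  the number of factors, and for \<open>k = 2\<close> it shows that at most two points share a coordinate on a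
  given factor, and that if two do, the other two share the coordinate on the other factor.

  The same principle, applied to \<open>a\<close>, \<open>b\<close> and a third point of the Segre variety on the secant
  line through \<open>a\<close> and \<open>b\<close>, shows that the other points of that line have rank 2 when \<open>a\<close> and
  \<open>b\<close> differ on both factors. The forms of bidegree \<open>(1,1)\<close> vanishing on \<open>S\<close> are the equations
  of a hyperplane, hence unique up to scalars; a reducible one splits into forms of bidegrees
  \<open>(1,0)\<close> and \<open>(0,1)\<close>, because factors of multihomogeneous polynomials are multihomogeneous.
\<close>

section \<open>Linear algebra of coordinate spaces\<close>

text \<open>The field may be small, so nothing is deduced from the values of a polynomial at many
  points: divisors are compared through the coefficients of their equations. On a product of two
  projective lines a form of bidegree (1,1) is a linear form in the four coordinates of the Segre
  target. Three points of the circuit are independent there and the fourth depends on them, which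
  leaves exactly one equation up to scalars. Reducibility is tested in the ring of polynomials in
  all variables \<open>(i, j)\<close>, where a factor could a priori be inhomogeneous or involve
  foreign variables. Weights that are additive on monomials exclude both. The principle of
  distributing points over the factors needs only a relation with nonzero coefficients, not a
  minimal one; hence it can be reused for one point, for two points and for three points on a line.
  Minimality of the circuit provides the nonzero coefficients, the independence of any three of the
  four points, and the uniqueness of the relation, which makes the two spans meet in a single
  point.\<close>

lemma sum_fun_apply: "(\<Sum>y\<in>T. f y) x = (\<Sum>y\<in>T. f y x)"
  by (induction T rule: infinite_finite_induct) auto

text \<open>Independence of an indexed family instead of a set of vectors: coefficients are attached
  to the points themselves, and a repeated vector counts as dependent.\<close>

definition lin_indep_on :: "'b set \<Rightarrow> ('b \<Rightarrow> 'i \<Rightarrow> 'a :: field) \<Rightarrow> bool" where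
  "lin_indep_on T t \<longleftrightarrow> (\<forall>c. (\<forall>x. (\<Sum>y\<in>T. c y * t y x) = 0) \<longrightarrow> (\<forall>y\<in>T. c y = 0))"

lemma lin_indep_onD:
  assumes "lin_indep_on T t" "\<And>x. (\<Sum>y\<in>T. c y * t y x) = 0" "y \<in> T"
  shows "c y = 0"
  using assms unfolding lin_indep_on_def by blast

lemma span_family_iff:
  fixes t :: "'b \<Rightarrow> 'i \<Rightarrow> 'a :: field"
  assumes "finite T"
  shows "v \<in> vec.span (t ` T) \<longleftrightarrow> (\<exists>c. v = (\<lambda>x. \<Sum>y\<in>T. c y * t y x))"
proof
  assume "v \<in> vec.span (t ` T)"
  then show "\<exists>c. v = (\<lambda>x. \<Sum>y\<in>T. c y * t y x)"
  proof (induction rule: vec.span_induct_alt)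
    case base
    show ?case by (rule exI[of _ "\<lambda>_. 0"]) (auto simp: fun_eq_iff)
  next
    case (step d w u)
    then obtain c y where c: "u = (\<lambda>x. \<Sum>y\<in>T. c y * t y x)" "w = t y" "y \<in> T" by blast
    show ?case
      using c assms
      by (intro exI[of _ "\<lambda>z. (if z = y then d else 0) + c z"])
        (auto simp: fun_eq_iff distrib_right sum.distrib if_distrib[of "\<lambda>r. r * _"] cong: if_cong)
  qed
next
  assume "\<exists>c. v = (\<lambda>x. \<Sum>y\<in>T. c y * t y x)"
  then obtain c where "v = (\<lambda>x. \<Sum>y\<in>T. c y * t y x)" by blast
  then have "v = (\<Sum>y\<in>T. (\<lambda>x. c y * t y x))"
    by (auto simp: fun_eq_iff sum_fun_apply)
  also have "\<dots> \<in> vec.span (t ` T)"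
    by (intro vec.span_sum vec.span_scale vec.span_base) auto
  finally show "v \<in> vec.span (t ` T)" .
qed

lemma hpoint_scale:
  fixes v :: "'i \<Rightarrow> 'a :: field"
  assumes "c \<noteq> 0"
  shows "hpoint (\<lambda>x. c * v x) = hpoint v"
proof -
  have "(\<lambda>x. c * v x) \<in> vec.span {v}"
    by (rule vec.span_scale) (simp add: vec.span_base)
  moreover have "(\<lambda>x. inverse c * (c * v x)) \<in> vec.span {\<lambda>x. c * v x}"
    by (rule vec.span_scale) (simp add: vec.span_base)
  then have "v \<in> vec.span {\<lambda>x. c * v x}" using assms by (simp flip: mult.assoc)
  ultimately show ?thesis
    unfolding hpoint_def by (simp add: vec.span_eq)
qed

lemma hpoint_eq_iff:
  fixes v w :: "'i \<Rightarrow> 'a :: field"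
  assumes "v \<noteq> 0"
  shows "hpoint v = hpoint w \<longleftrightarrow> v \<in> vec.span {w}"
proof
  assume "hpoint v = hpoint w"
  then show "v \<in> vec.span {w}"
    by (metis hpoint_def vec.span_base singletonI)
next
  assume "v \<in> vec.span {w}"
  then obtain c where c: "v = (\<lambda>x. c * w x)" by (auto simp: vec.span_singleton)
  with assms have "c \<noteq> 0" by (auto simp: fun_eq_iff)
  then show "hpoint v = hpoint w" unfolding c by (rule hpoint_scale)
qed

lemma hpoint_scaleD:
  fixes v w :: "'i \<Rightarrow> 'a :: field"
  assumes "hpoint v = hpoint w" "v \<noteq> 0"
  obtains c where "c \<noteq> 0" "v = (\<lambda>x. c * w x)"
proof -
  have "v \<in> vec.span {w}" using assms by (metis hpoint_def vec.span_base singletonI)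
  then obtain c where c: "v = (\<lambda>x. c * w x)" by (auto simp: vec.span_singleton)
  with assms have "c \<noteq> 0" by (auto simp: fun_eq_iff)
  with c that show thesis by blast
qed

lemma independent_image_iff:
  fixes t :: "'b \<Rightarrow> 'i \<Rightarrow> 'a :: field"
  assumes "finite T" "inj_on t T"
  shows "vec.independent (t ` T) \<longleftrightarrow> lin_indep_on T t"
proof
  assume ind: "vec.independent (t ` T)"
  show "lin_indep_on T t"
    unfolding lin_indep_on_def
  proof (intro allI impI ballI)
    fix c y
    assume c: "\<forall>x. (\<Sum>y\<in>T. c y * t y x) = 0" and "y \<in> T"
    have "(\<Sum>v\<in>t ` T. (\<lambda>x. c (inv_into T t v) * v x)) = (\<Sum>y\<in>T. (\<lambda>x. c y * t y x))"
      using assms by (simp add: sum.reindex cong: sum.cong)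
    also have "\<dots> = 0" using c by (auto simp: fun_eq_iff sum_fun_apply)
    finally show "c y = 0"
      using vec.independentD[OF ind, of "t ` T" "\<lambda>v. c (inv_into T t v)" "t y"] assms \<open>y \<in> T\<close> by auto
  qed
next
  assume "lin_indep_on T t"
  show "vec.independent (t ` T)"
  proof (rule vec.independent_if_scalars_zero)
    fix f v
    assume "(\<Sum>v\<in>t ` T. (\<lambda>x. f v * v x)) = 0" "v \<in> t ` T"
    then have "(\<Sum>y\<in>T. f (t y) * t y x) = 0" for x
      using assms by (simp add: sum.reindex fun_eq_iff sum_fun_apply)
    with \<open>v \<in> t ` T\<close> show "f v = 0"
      using lin_indep_onD[OF \<open>lin_indep_on T t\<close>, of "\<lambda>y. f (t y)"] by auto
  qed (use assms in auto)
qed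

text \<open>\<open>proj_independent\<close> allows any choice \<open>B\<close> of representatives.
  Each \<open>t y\<close> is a nonzero multiple of its representative, and the scalar can be
  absorbed into the coefficient of a relation.\<close>

lemma proj_independent_iff:
  fixes t :: "'b \<Rightarrow> 'i \<Rightarrow> 'a :: field"
  assumes fin: "finite T" and inj: "inj_on (\<lambda>y. hpoint (t y)) T"
    and nz: "\<And>y. y \<in> T \<Longrightarrow> t y \<noteq> 0"
  shows "proj_independent ((\<lambda>y. hpoint (t y)) ` T) \<longleftrightarrow> lin_indep_on T t"
proof
  have injt: "inj_on t T" using inj by (auto simp: inj_on_def)
  assume "lin_indep_on T t"
  then have "vec.independent (t ` T)"
    using independent_image_iff[OF fin injt] by blast
  then show "proj_independent ((\<lambda>y. hpoint (t y)) ` T)"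
    unfolding proj_independent_def by (intro exI[of _ "t ` T"]) (auto simp: image_image)
next
  assume "proj_independent ((\<lambda>y. hpoint (t y)) ` T)"
  then obtain B where B: "vec.independent B" "(\<lambda>y. hpoint (t y)) ` T = hpoint ` B"
    unfolding proj_independent_def by blast
  have "\<exists>b d. b \<in> B \<and> d \<noteq> 0 \<and> t y = (\<lambda>x. d * b x) \<and> hpoint (t y) = hpoint b" if "y \<in> T" for y
  proof -
    from B(2) that obtain b where "b \<in> B" "hpoint (t y) = hpoint b" by blast
    with hpoint_scaleD[of "t y" b] nz[OF that] show ?thesis by metis
  qed
  then obtain b d where bd: "\<And>y. y \<in> T \<Longrightarrow> b y \<in> B" "\<And>y. y \<in> T \<Longrightarrow> d y \<noteq> 0"
    "\<And>y. y \<in> T \<Longrightarrow> t y = (\<lambda>x. d y * b y x)" "\<And>y. y \<in> T \<Longrightarrow> hpoint (t y) = hpoint (b y)"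
    by metis
  have injb: "inj_on b T" using inj bd(4) by (auto simp: inj_on_def)
  show "lin_indep_on T t"
    unfolding lin_indep_on_def
  proof (intro allI impI ballI)
    fix c y
    assume c: "\<forall>x. (\<Sum>y\<in>T. c y * t y x) = 0" and "y \<in> T"
    \<comment> \<open>The coefficient of \<open>b y\<close> in the transported relation is
      \<open>c y * d y\<close>, read off through the inverse of \<open>b\<close>.\<close>
    define u where "u v = c (inv_into T b v) * d (inv_into T b v)" for v
    have u: "u (b y) = c y * d y" if "y \<in> T" for y
      using that injb by (simp add: u_def)
    have "(\<lambda>x. u (b z) * b z x) = (\<lambda>x. c z * t z x)" if "z \<in> T" for z
      by (simp only: u[OF that] bd(3)[OF that] mult.assoc)
    then have "(\<Sum>z\<in>T. (\<lambda>x. u (b z) * b z x)) = (\<Sum>z\<in>T. (\<lambda>x. c z * t z x))"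
      by (rule sum.cong[OF refl])
    then have "(\<Sum>v\<in>b ` T. (\<lambda>x. u v * v x)) = (\<Sum>z\<in>T. (\<lambda>x. c z * t z x))"
      by (simp only: sum.reindex[OF injb] o_def)
    also have "\<dots> = 0" using c by (auto simp: fun_eq_iff sum_fun_apply)
    finally have "u (b y) = 0"
      using vec.independentD[OF B(1), of "b ` T" u "b y"] fin bd(1) \<open>y \<in> T\<close> by auto
    with u bd(2) \<open>y \<in> T\<close> show "c y = 0" by simp
  qed
qed

lemma lin_indep_on_imp_inj:
  fixes t :: "'b \<Rightarrow> 'i \<Rightarrow> 'a :: field"
  assumes "finite T" "lin_indep_on T t"
  shows "inj_on t T"
proof (rule inj_onI, rule ccontr)
  fix y z assume yz: "y \<in> T" "z \<in> T" "t y = t z" "y \<noteq> z"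
  define c where "c x = (if x = y then 1 else if x = z then -1 else (0::'a))" for x
  have "(\<Sum>w\<in>T. c w * t w x) = (\<Sum>w\<in>{y,z}. c w * t w x)" for x
    using assms yz by (intro sum.mono_neutral_right) (auto simp: c_def)
  also have "\<dots> x = 0" for x using yz by (simp add: c_def)
  finally have "c y = 0" using lin_indep_onD[OF assms(2), of c y] yz by auto
  then show False by (simp add: c_def)
qed

section \<open>Coordinate spaces, linear forms and hyperplanes\<close>

definition unit_vec :: "'i \<Rightarrow> 'i \<Rightarrow> 'a :: field" where
  "unit_vec j = (\<lambda>x. if x = j then 1 else 0)"

lemma subspace_coord_space: "vec.subspace (coord_space I)"
  by (auto simp: vec.subspace_def coord_space_def)

lemma coord_space_unit_expansion:
  fixes v :: "'i \<Rightarrow> 'a :: field"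
  assumes "finite I" "v \<in> coord_space I"
  shows "v = (\<lambda>x. \<Sum>j\<in>I. v j * unit_vec j x)"
  using assms by (auto simp: unit_vec_def coord_space_def if_distrib cong: if_cong)

lemma span_unit_vec:
  assumes "finite I"
  shows "vec.span (unit_vec ` I) = (coord_space I :: ('i \<Rightarrow> 'a :: field) set)"
proof
  show "vec.span (unit_vec ` I) \<subseteq> (coord_space I :: ('i \<Rightarrow> 'a) set)"
    by (intro vec.span_minimal subspace_coord_space) (auto simp: coord_space_def unit_vec_def)
  show "coord_space I \<subseteq> vec.span (unit_vec ` I :: ('i \<Rightarrow> 'a) set)"
  proof
    fix v :: "'i \<Rightarrow> 'a" assume "v \<in> coord_space I"
    then show "v \<in> vec.span (unit_vec ` I)"
      unfolding span_family_iff[OF assms]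
      using coord_space_unit_expansion[OF assms, of v] by (intro exI[of _ v])
  qed
qed

lemma lin_indep_unit_vec: "finite I \<Longrightarrow> lin_indep_on I (unit_vec :: 'i \<Rightarrow> 'i \<Rightarrow> 'a :: field)"
  by (auto simp: lin_indep_on_def unit_vec_def if_distrib cong: if_cong)

lemma dim_coord_space:
  assumes "finite I"
  shows "vec.dim (coord_space I :: ('i \<Rightarrow> 'a :: field) set) = card I"
proof -
  have inj: "inj_on (unit_vec :: 'i \<Rightarrow> 'i \<Rightarrow> 'a) I"
    by (auto simp: inj_on_def unit_vec_def fun_eq_iff split: if_splits)
  then have "vec.independent (unit_vec ` I :: ('i \<Rightarrow> 'a) set)"
    using independent_image_iff[OF assms inj] lin_indep_unit_vec[OF assms] by blast
  from vec.dim_span_eq_card_independent[OF this] show ?thesis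
    by (simp add: span_unit_vec assms card_image inj)
qed

text \<open>The linear form with coefficients \<open>u\<close>. Keeping functionals as coefficient
  vectors lets them be multiplied across the factors and compared with coefficients of
  polynomials.\<close>

definition pairing :: "'i set \<Rightarrow> ('i \<Rightarrow> 'a :: field) \<Rightarrow> ('i \<Rightarrow> 'a) \<Rightarrow> 'a" where
  "pairing I u v = (\<Sum>j\<in>I. u j * v j)"

lemma pairing_sum_right:
  "pairing I u (\<lambda>x. \<Sum>y\<in>T. c y * t y x) = (\<Sum>y\<in>T. c y * pairing I u (t y))"
  unfolding pairing_def sum_distrib_left by (subst sum.swap) (simp add: ac_simps)

lemma pairing_unit_vec: "finite I \<Longrightarrow> j \<in> I \<Longrightarrow> pairing I u (unit_vec j) = u j"
  by (simp add: pairing_def unit_vec_def if_distrib cong: if_cong)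

lemma linear_is_pairing:
  fixes \<phi> :: "('i \<Rightarrow> 'a :: field) \<Rightarrow> 'a"
  assumes "Vector_Spaces.linear (\<lambda>c v x. c * v x) (*) \<phi>" "finite I" "v \<in> coord_space I"
  shows "\<phi> v = pairing I (\<lambda>j. \<phi> (unit_vec j)) v"
proof -
  interpret l: Vector_Spaces.linear "\<lambda>c (v :: 'i \<Rightarrow> 'a) x. c * v x" "(*)" \<phi> by fact
  have "v = (\<Sum>j\<in>I. (\<lambda>x. v j * unit_vec j x))"
    by (subst coord_space_unit_expansion[OF assms(2,3)]) (simp add: fun_eq_iff sum_fun_apply)
  then have "\<phi> v = \<phi> (\<Sum>j\<in>I. (\<lambda>x. v j * unit_vec j x))" by (rule arg_cong)
  also have "\<dots> = pairing I (\<lambda>j. \<phi> (unit_vec j)) v"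
    by (simp add: l.sum l.scale pairing_def mult.commute)
  finally show ?thesis .
qed

text \<open>Adjoining \<open>v\<close> to a basis of the span of \<open>W\<close> keeps it
  independent, so some functional is 1 at \<open>v\<close> and 0 on that basis. Its values at the
  unit vectors are the coefficients \<open>u\<close>.\<close>

lemma separating_functional:
  fixes v :: "'i \<Rightarrow> 'a :: field"
  assumes fin: "finite I" and v: "v \<in> coord_space I" and W: "W \<subseteq> coord_space I"
    and notin: "v \<notin> vec.span W"
  obtains u where "pairing I u v \<noteq> 0" "\<And>w. w \<in> W \<Longrightarrow> pairing I u w = 0"
proof -
  interpret sc: vector_space "(*) :: 'a \<Rightarrow> 'a \<Rightarrow> 'a"
    by unfold_locales (auto simp: algebra_simps)
  interpret p: vector_space_pair "\<lambda>c (v :: 'i \<Rightarrow> 'a) x. c * v x" "(*) :: 'a \<Rightarrow> 'a \<Rightarrow> 'a"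
    by unfold_locales
  obtain B where B: "B \<subseteq> W" "vec.independent B" "W \<subseteq> vec.span B"
    using vec.maximal_independent_subset[of W] by blast
  have "vec.span B = vec.span W" using B
    by (metis vec.span_eq vec.span_superset subset_trans)
  with notin have nB: "v \<notin> vec.span B" by simp
  then have "vec.independent (insert v B)" by (rule vec.independent_insertI) (rule B)
  from p.linear_independent_extend[OF this, of "\<lambda>x. if x = v then 1 else 0"]
  obtain \<phi> where \<phi>: "Vector_Spaces.linear (\<lambda>c (v :: 'i \<Rightarrow> 'a) x. c * v x) (*) \<phi>"
    "\<And>x. x \<in> insert v B \<Longrightarrow> \<phi> x = (if x = v then 1 else 0)" by blast
  have "\<phi> v = 1" using \<phi>(2) by simp
  moreover have "\<phi> w = 0" if "w \<in> W" for w
  proof (rule p.linear_eq_0_on_span[OF \<phi>(1)])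
    show "w \<in> vec.span B" using that B by blast
    show "\<phi> b = 0" if "b \<in> B" for b
      using that \<phi>(2) nB by (auto simp: vec.span_base)
  qed
  ultimately show thesis
    using that[of "\<lambda>j. \<phi> (unit_vec j)"] linear_is_pairing[OF \<phi>(1) fin] v W by (metis subsetD zero_neq_one)
qed

text \<open>The vectors of \<open>T\<close> together with one vector \<open>e\<close> outside their
  span form a basis of the coordinate space. \<open>F\<close> vanishes on \<open>T\<close> but not
  at \<open>e\<close>, so for every \<open>G\<close> vanishing on \<open>T\<close> a suitable
  multiple of \<open>F\<close> agrees with \<open>G\<close> on the whole basis.\<close>

lemma hyperplane_equation:
  fixes t :: "'b \<Rightarrow> 'i \<Rightarrow> 'a :: field"
  assumes fin: "finite I" "finite T" and T: "\<And>y. y \<in> T \<Longrightarrow> t y \<in> coord_space I"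
    and ind: "lin_indep_on T t" and card: "card I = Suc (card T)"
  obtains F where "\<And>y. y \<in> T \<Longrightarrow> pairing I F (t y) = 0" "\<exists>j\<in>I. F j \<noteq> 0"
    "\<And>G. (\<And>y. y \<in> T \<Longrightarrow> pairing I G (t y) = 0) \<Longrightarrow> \<exists>c. \<forall>j\<in>I. G j = c * F j"
proof -
  have inj: "inj_on t T" using lin_indep_on_imp_inj[OF fin(2) ind] .
  have indB: "vec.independent (t ` T)" using independent_image_iff[OF fin(2) inj] ind by blast
  have sub: "t ` T \<subseteq> coord_space I" using T by auto
  have "\<not> coord_space I \<subseteq> vec.span (t ` T)"
  proof
    assume "coord_space I \<subseteq> vec.span (t ` T)"
    then have "vec.dim (coord_space I :: ('i \<Rightarrow> 'a) set) = card (t ` T)"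
      using vec.basis_card_eq_dim[OF sub _ indB] by simp
    then show False using card by (simp add: dim_coord_space fin card_image inj)
  qed
  then obtain e where e: "e \<in> coord_space I" "e \<notin> vec.span (t ` T)" by blast
  obtain F where F: "pairing I F e \<noteq> 0" "\<And>w. w \<in> t ` T \<Longrightarrow> pairing I F w = 0"
    using separating_functional[OF fin(1) e(1) sub e(2)] by blast
  have indE: "vec.independent (insert e (t ` T))" using vec.independent_insertI[OF e(2) indB] .
  have "e \<notin> t ` T" using e(2) by (auto simp: vec.span_base)
  then have cardE: "card (insert e (t ` T)) = card I" using fin card by (simp add: card_image inj)
  have spanning: "vec.span (insert e (t ` T)) = coord_space I"
  proof
    show "vec.span (insert e (t ` T)) \<subseteq> coord_space I"
      using e(1) sub by (intro vec.span_minimal subspace_coord_space) auto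
    show "coord_space I \<subseteq> vec.span (insert e (t ` T))"
    proof (rule ccontr)
      assume "\<not> ?thesis"
      \<comment> \<open>Otherwise there would be \<open>card I + 1\<close> independent vectors in a
        space spanned by \<open>card I\<close> unit vectors.\<close>
      then obtain x where x: "x \<in> coord_space I" "x \<notin> vec.span (insert e (t ` T))" by blast
      have "vec.independent (insert x (insert e (t ` T)))"
        using x(2) indE by (rule vec.independent_insertI)
      moreover have "insert x (insert e (t ` T)) \<subseteq> vec.span (unit_vec ` I)"
        using x e sub by (auto simp: span_unit_vec fin)
      ultimately have "card (insert x (insert e (t ` T))) \<le> card (unit_vec ` I :: ('i \<Rightarrow> 'a) set)"
        using vec.independent_span_bound[OF finite_imageI[OF fin(1)]] by blast
      moreover have "x \<notin> insert e (t ` T)" using x(2) vec.span_base[of x] by metis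
      then have "card (insert x (insert e (t ` T))) = Suc (card I)"
        using fin(2) by (simp only: card_insert_disjoint finite_insert finite_imageI cardE not_False_eq_True)
      ultimately show False
        using card_image_le[OF fin(1), of "unit_vec :: 'i \<Rightarrow> 'i \<Rightarrow> 'a"] by linarith
    qed
  qed
  show thesis
  proof (rule that[of F])
    show "\<And>y. y \<in> T \<Longrightarrow> pairing I F (t y) = 0" using F by auto
    show "\<exists>j\<in>I. F j \<noteq> 0" using F(1) by (auto simp: pairing_def dest: sum.not_neutral_contains_not_neutral)
    fix G assume G: "\<And>y. y \<in> T \<Longrightarrow> pairing I G (t y) = 0"
    define c where "c = pairing I G e / pairing I F e"
    have *: "pairing I G w - c * pairing I F w = 0" if "w \<in> vec.span (insert e (t ` T))" for w
      using that
    proof (induction rule: vec.span_induct_alt)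
      case base
      then show ?case by (simp add: pairing_def)
    next
      case (step d w u)
      have *: "pairing I G w - c * pairing I F w = 0"
        using step(1) F G by (auto simp: c_def)
      have "pairing I H ((\<lambda>x. d * w x) + u) = d * pairing I H w + pairing I H u" for H
        by (simp add: pairing_def sum.distrib sum_distrib_left algebra_simps)
      then have "pairing I G ((\<lambda>x. d * w x) + u) - c * pairing I F ((\<lambda>x. d * w x) + u) =
        d * (pairing I G w - c * pairing I F w) + (pairing I G u - c * pairing I F u)"
        by (simp add: algebra_simps)
      then show ?case using * step(2) by (simp add: plus_fun_def)
    qed
    have "pairing I G (unit_vec j) = c * pairing I F (unit_vec j)" if "j \<in> I" for j
    proof -
      have "unit_vec j \<in> vec.span (insert e (t ` T))"
        unfolding spanning using that by (auto simp: coord_space_def unit_vec_def)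
      with * show ?thesis by (metis right_minus_eq)
    qed
    then show "\<exists>c. \<forall>j\<in>I. G j = c * F j" using pairing_unit_vec[OF fin(1)] by metis
  qed
qed

section \<open>Relations between points of the Segre variety\<close>

definition rep :: "(nat \<Rightarrow> (nat \<Rightarrow> 'a :: field) set) \<Rightarrow> nat \<Rightarrow> nat \<Rightarrow> 'a" where
  "rep y i = (SOME u. u \<in> y i \<and> u \<noteq> 0)"

definition segre_rep ::
  "nat \<Rightarrow> (nat \<Rightarrow> nat) \<Rightarrow> (nat \<Rightarrow> (nat \<Rightarrow> 'a :: field) set) \<Rightarrow> (nat \<Rightarrow> nat) \<Rightarrow> 'a" where
  "segre_rep k n y = segre_coords k n (rep y)"

lemma rep:
  assumes "y \<in> multiproj k n" "i \<in> {1..k}"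
  shows rep_coord_space: "rep y i \<in> coord_space {0..n i}"
    and rep_nonzero: "rep y i \<noteq> 0" and hpoint_rep: "hpoint (rep y i) = y i"
proof -
  have "y i \<in> proj_space (n i)"
    using assms by (auto simp: multiproj_def dest: PiE_mem)
  then obtain u where u: "u \<in> coord_space {0..n i}" "u \<noteq> 0" "y i = hpoint u"
    by (auto simp: proj_space_def proj_of_def)
  then have "u \<in> y i \<and> u \<noteq> 0" by (simp add: hpoint_def vec.span_base)
  then have r: "rep y i \<in> y i \<and> rep y i \<noteq> 0"
    unfolding rep_def by (rule someI[where P = "\<lambda>u. u \<in> y i \<and> u \<noteq> 0"])
  then show "rep y i \<noteq> 0" by simp
  have "rep y i \<in> vec.span {u}" using r u by (simp add: hpoint_def)
  then show "hpoint (rep y i) = y i" using u r hpoint_eq_iff by blast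
  have "vec.span {u} \<subseteq> coord_space {0..n i}"
    using u by (intro vec.span_minimal subspace_coord_space) auto
  then show "rep y i \<in> coord_space {0..n i}" using \<open>rep y i \<in> vec.span {u}\<close> by blast
qed

text \<open>Turns the span condition for a factor with one assigned point into equality of
  coordinates.\<close>

lemma rep_in_span_singleton_iff:
  assumes "a \<in> multiproj k n" "b \<in> multiproj k n" "i \<in> {1..k}"
  shows "rep a i \<in> vec.span {rep b i} \<longleftrightarrow> a i = b i"
  using hpoint_eq_iff[OF rep_nonzero[OF assms(1,3)], of "rep b i"]
    hpoint_rep[OF assms(1,3)] hpoint_rep[OF assms(2,3)] by simp

lemma multiproj_eqI:
  assumes "a \<in> multiproj k n" "b \<in> multiproj k n" "\<And>i. i \<in> {1..k} \<Longrightarrow> a i = b i"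
  shows "a = b"
  using assms unfolding multiproj_def by (rule PiE_ext)

lemma segre_eq_hpoint: "y \<in> multiproj k n \<Longrightarrow> segre k n y = hpoint (segre_rep k n y)"
  unfolding segre_rep_def by (rule segre_hpoint) (simp add: hpoint_rep)

lemma finite_multi_indices: "finite (multi_indices k n)"
  by (simp add: multi_indices_def finite_PiE)

lemma segre_rep_coord_space: "segre_rep k n y \<in> coord_space (multi_indices k n)"
  by (simp add: segre_rep_def segre_coords_def coord_space_def)

text \<open>Distributivity of products over sums: a product of linear forms, one on each factor, is
  a linear form on the Segre target whose value at a decomposable tensor is the product of the
  values.\<close>

lemma pairing_segre_coords:
  "pairing (multi_indices k n) (\<lambda>J. \<Prod>i\<in>{1..k}. u i (J i)) (segre_coords k n v) =
    (\<Prod>i\<in>{1..k}. pairing {0..n i} (u i) (v i))"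
proof -
  have "pairing (multi_indices k n) (\<lambda>J. \<Prod>i\<in>{1..k}. u i (J i)) (segre_coords k n v) =
    (\<Sum>J\<in>multi_indices k n. \<Prod>i\<in>{1..k}. u i (J i) * v i (J i))"
    by (simp add: pairing_def segre_coords_def prod.distrib)
  also have "\<dots> = (\<Prod>i\<in>{1..k}. pairing {0..n i} (u i) (v i))"
    unfolding multi_indices_def pairing_def by (rule prod_sum_PiE[symmetric]) auto
  finally show ?thesis .
qed

text \<open>Minimality is not part of this locale: it is interpreted below also for a single point,
  for two points with proportional tensors, and for three points of the Segre variety on one
  line.\<close>

locale segre_relation =
  fixes k :: nat and n :: "nat \<Rightarrow> nat"
    and S :: "(nat \<Rightarrow> (nat \<Rightarrow> 'a :: field) set) set"
    and c :: "(nat \<Rightarrow> (nat \<Rightarrow> 'a) set) \<Rightarrow> 'a"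
  assumes finite_S: "finite S" and S_sub: "S \<subseteq> multiproj k n"
    and c_nonzero: "\<And>y. y \<in> S \<Longrightarrow> c y \<noteq> 0"
    and relation: "\<And>J. (\<Sum>y\<in>S. c y * segre_rep k n y J) = 0"
begin

text \<open>
  Apply to the relation a product of linear forms, where the form on the factor \<open>i\<close> vanishes
  at the points sent to \<open>i\<close> by \<open>g\<close>: only the term of \<open>a\<close> could survive.
\<close>

lemma in_span_of_assigned:
  assumes a: "a \<in> S" and g: "\<And>b. b \<in> S - {a} \<Longrightarrow> g b \<in> {1..k}"
  shows "\<exists>i\<in>g ` (S - {a}). rep a i \<in> vec.span ((\<lambda>b. rep b i) ` {b \<in> S - {a}. g b = i})"
proof (rule ccontr)
  assume no: "\<not> ?thesis"
  have not_in: "rep a i \<notin> vec.span ((\<lambda>b. rep b i) ` {b \<in> S - {a}. g b = i})"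
    if "i \<in> {1..k}" for i
  proof (cases "i \<in> g ` (S - {a})")
    case True
    with no show ?thesis by blast
  next
    \<comment> \<open>On a factor with no assigned point the span is zero, and any form not
      vanishing at \<open>a\<close> will do.\<close>
    case False
    then have "{b \<in> S - {a}. g b = i} = {}" by blast
    moreover have "rep a i \<noteq> 0" using rep_nonzero a S_sub that by blast
    ultimately show ?thesis by (simp only: image_empty vec.span_empty singleton_iff not_False_eq_True)
  qed
  have "\<exists>u. pairing {0..n i} u (rep a i) \<noteq> 0 \<and>
      (\<forall>b\<in>S - {a}. g b = i \<longrightarrow> pairing {0..n i} u (rep b i) = 0)" if i: "i \<in> {1..k}" for i
  proof -
    have "rep a i \<in> coord_space {0..n i}" using a S_sub i by (auto intro: rep_coord_space)
    moreover have "(\<lambda>b. rep b i) ` {b \<in> S - {a}. g b = i} \<subseteq> coord_space {0..n i}"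
      using S_sub i by (auto intro!: rep_coord_space)
    ultimately obtain u where "pairing {0..n i} u (rep a i) \<noteq> 0"
      "\<And>w. w \<in> (\<lambda>b. rep b i) ` {b \<in> S - {a}. g b = i} \<Longrightarrow> pairing {0..n i} u w = 0"
      using separating_functional[OF _ _ _ not_in[OF i]] by blast
    then show ?thesis by blast
  qed
  then obtain u where u: "\<And>i. i \<in> {1..k} \<Longrightarrow> pairing {0..n i} (u i) (rep a i) \<noteq> 0"
    "\<And>i b. i \<in> {1..k} \<Longrightarrow> b \<in> S - {a} \<Longrightarrow> g b = i \<Longrightarrow> pairing {0..n i} (u i) (rep b i) = 0"
    by metis
  let ?P = "\<lambda>y. \<Prod>i\<in>{1..k}. pairing {0..n i} (u i) (rep y i)"
  have "0 = pairing (multi_indices k n) (\<lambda>J. \<Prod>i\<in>{1..k}. u i (J i))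
      (\<lambda>J. \<Sum>y\<in>S. c y * segre_rep k n y J)"
    by (simp add: relation pairing_def)
  also have "\<dots> = (\<Sum>y\<in>S. c y * ?P y)"
    unfolding pairing_sum_right segre_rep_def pairing_segre_coords ..
  also have "\<dots> = c a * ?P a + (\<Sum>y\<in>S - {a}. c y * ?P y)"
    using a finite_S by (simp add: sum.remove)
  also have "(\<Sum>y\<in>S - {a}. c y * ?P y) = 0"
  proof (rule sum.neutral, intro ballI)
    fix b assume b: "b \<in> S - {a}"
    have "?P b = 0" using u(2)[OF g[OF b] b refl] g[OF b] by (intro prod_zero) auto
    then show "c b * ?P b = 0" by simp
  qed
  finally have "c a * ?P a = 0" by simp
  moreover have "?P a \<noteq> 0" using u(1) by simp
  ultimately show False using c_nonzero[OF a] by simp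
qed

lemma rep_in_span_singleton:
  assumes "a \<in> S" "b \<in> S" "i \<in> {1..k}"
  shows "rep a i \<in> vec.span {rep b i} \<longleftrightarrow> a i = b i"
  using rep_in_span_singleton_iff[OF _ _ assms(3)] assms S_sub by blast

text \<open>Assign \<open>e\<close> to \<open>j\<close>, and \<open>b\<close> and \<open>d\<close>
  to \<open>i\<close>. As \<open>b\<close> and \<open>d\<close> agree on \<open>i\<close>, they span
  a single line there, so both alternatives become equalities of coordinates.\<close>

lemma equal_factors_cases:
  assumes S: "S = {a, b, d, e}" and dist: "a \<noteq> b" "a \<noteq> d" "a \<noteq> e" "b \<noteq> e" "d \<noteq> e"
    and ij: "i \<in> {1..k}" "j \<in> {1..k}" "i \<noteq> j" and "b i = d i"
  shows "a i = b i \<or> a j = e j"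
proof -
  define g where "g x = (if x = e then j else i)" for x :: "nat \<Rightarrow> (nat \<Rightarrow> 'a) set"
  have "\<exists>i\<in>g ` (S - {a}). rep a i \<in> vec.span ((\<lambda>z. rep z i) ` {z \<in> S - {a}. g z = i})"
    by (rule in_span_of_assigned) (use S ij in \<open>auto simp: g_def\<close>)
  moreover have "g ` (S - {a}) \<subseteq> {i, j}" by (auto simp: g_def)
  ultimately consider "rep a i \<in> vec.span ((\<lambda>z. rep z i) ` {z \<in> S - {a}. g z = i})"
    | "rep a j \<in> vec.span ((\<lambda>z. rep z j) ` {z \<in> S - {a}. g z = j})"
    by blast
  then show ?thesis
  proof cases
    case 1
    have "{b \<in> S - {a}. g b = i} = {d, b}" using S dist ij by (auto simp: g_def)
    with 1 have "rep a i \<in> vec.span (insert (rep d i) {rep b i})" by simp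
    moreover have "rep d i \<in> vec.span {rep b i}"
      using rep_in_span_singleton[of d b i] S ij \<open>b i = d i\<close> by simp
    then have "vec.span (insert (rep d i) {rep b i}) = vec.span {rep b i}"
      by (rule vec.span_redundant)
    ultimately show ?thesis using rep_in_span_singleton[of a b i] S ij by simp
  next
    case 2
    have "{b \<in> S - {a}. g b = j} = {e}" using S dist ij by (auto simp: g_def)
    with 2 have "rep a j \<in> vec.span {rep e j}" by simp
    then show ?thesis using rep_in_span_singleton[of a e j] S ij by simp
  qed
qed

text \<open>All three other points are assigned to \<open>i\<close>, where they span one
  line.\<close>

lemma three_equal_imp_all_equal:
  assumes S: "S = {a, b, d, e}" and dist: "a \<noteq> b" "a \<noteq> d" "a \<noteq> e"
    and i: "i \<in> {1..k}" and eq: "b i = d i" "b i = e i"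
  shows "a i = b i"
proof -
  have "rep a i \<in> vec.span ((\<lambda>z. rep z i) ` {z \<in> S - {a}. i = i})"
    using in_span_of_assigned[of a "\<lambda>_. i"] i S by (elim bexE imageE meta_impE) simp_all
  moreover have "(\<lambda>z. rep z i) ` {z \<in> S - {a}. i = i} \<subseteq> vec.span {rep b i}"
    using rep_in_span_singleton[of _ b i] S eq i by auto
  then have "vec.span ((\<lambda>z. rep z i) ` {z \<in> S - {a}. i = i}) \<subseteq> vec.span {rep b i}"
    by (intro vec.span_minimal vec.subspace_span)
  ultimately show ?thesis using rep_in_span_singleton[of a b i] S i by blast
qed

text \<open>With three factors at hand, each of the other points gets a factor of its own.\<close>

lemma equal_in_some_of_three:
  assumes S: "S = {a, b, d, e}" and dist: "a \<noteq> b" "a \<noteq> d" "a \<noteq> e" "b \<noteq> d" "b \<noteq> e" "d \<noteq> e"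
    and ijl: "i \<in> {1..k}" "j \<in> {1..k}" "l \<in> {1..k}" "i \<noteq> j" "i \<noteq> l" "j \<noteq> l"
  shows "a i = b i \<or> a j = d j \<or> a l = e l"
proof -
  define g where "g x = (if x = b then i else if x = d then j else l)" for x :: "nat \<Rightarrow> (nat \<Rightarrow> 'a) set"
  have "\<exists>i\<in>g ` (S - {a}). rep a i \<in> vec.span ((\<lambda>z. rep z i) ` {z \<in> S - {a}. g z = i})"
    by (rule in_span_of_assigned) (use S ijl in \<open>auto simp: g_def\<close>)
  moreover have "g ` (S - {a}) \<subseteq> {i, j, l}" by (auto simp: g_def)
  ultimately consider "rep a i \<in> vec.span ((\<lambda>z. rep z i) ` {z \<in> S - {a}. g z = i})"
    | "rep a j \<in> vec.span ((\<lambda>z. rep z j) ` {z \<in> S - {a}. g z = j})"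
    | "rep a l \<in> vec.span ((\<lambda>z. rep z l) ` {z \<in> S - {a}. g z = l})"
    by blast
  then show ?thesis
  proof cases
    case 1
    have "{z \<in> S - {a}. g z = i} = {b}" using S dist ijl by (auto simp: g_def)
    then show ?thesis using 1 rep_in_span_singleton[of a b i] S ijl by simp
  next
    case 2
    have "{z \<in> S - {a}. g z = j} = {d}" using S dist ijl by (auto simp: g_def)
    then show ?thesis using 2 rep_in_span_singleton[of a d j] S ijl by simp
  next
    case 3
    have "{z \<in> S - {a}. g z = l} = {e}" using S dist ijl by (auto simp: g_def)
    then show ?thesis using 3 rep_in_span_singleton[of a e l] S ijl by simp
  qed
qed

end

section \<open>Injectivity of the Segre map and the relation of a circuit\<close>

lemma segre_rep_nonzero:
  assumes "a \<in> multiproj k n"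
  shows "segre_rep k n a \<noteq> 0"
proof
  assume *: "segre_rep k n a = 0"
  interpret segre_relation k n "{a}" "\<lambda>_. 1"
    by unfold_locales (use assms * in auto)
  \<comment> \<open>There is no other point to assign, so the promised factor would lie in an empty
    set; the value 0 of the assignment is a dummy.\<close>
  show False using in_span_of_assigned[of a "\<lambda>_. 0"] by simp
qed

text \<open>Two points with the same image have proportional tensors, which is a relation on a pair.
  Assigning \<open>b\<close> to a factor on which the points differ contradicts it.\<close>

lemma segre_inj_on: "inj_on (segre k n) (multiproj k n :: (nat \<Rightarrow> (nat \<Rightarrow> 'a :: field) set) set)"
proof (rule inj_onI, rule ccontr)
  fix a b :: "nat \<Rightarrow> (nat \<Rightarrow> 'a) set"
  assume ab: "a \<in> multiproj k n" "b \<in> multiproj k n" "segre k n a = segre k n b" "a \<noteq> b"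
  then have "hpoint (segre_rep k n a) = hpoint (segre_rep k n b)"
    by (simp add: segre_eq_hpoint)
  then obtain r where r: "r \<noteq> 0" "segre_rep k n a = (\<lambda>J. r * segre_rep k n b J)"
    by (rule hpoint_scaleD[OF _ segre_rep_nonzero[OF ab(1)]])
  have "(\<Sum>y\<in>{a, b}. (if y = a then 1 else - r) * segre_rep k n y J) = 0" for J
    using ab(4) fun_cong[OF r(2), of J] by simp
  then interpret segre_relation k n "{a, b}" "\<lambda>y. if y = a then 1 else - r"
    using ab(1,2) r(1) by unfold_locales simp_all
  obtain i where i: "i \<in> {1..k}" "a i \<noteq> b i" using multiproj_eqI[OF ab(1,2)] ab(4) by blast
  have "{y \<in> {a, b} - {a}. i = i} = {b}" using ab by auto
  then have "rep a i \<in> vec.span {rep b i}"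
    using in_span_of_assigned[of a "\<lambda>_. i"] i by auto
  then show False using i rep_in_span_singleton[of a b i] by simp
qed

text \<open>By injectivity of the Segre map, relations between the images can be indexed by the
  points.\<close>

lemma segre_independent_iff:
  assumes "finite T" "T \<subseteq> multiproj k n"
  shows "segre_independent k n T \<longleftrightarrow> lin_indep_on T (segre_rep k n)"
proof -
  have eqy: "segre k n y = hpoint (segre_rep k n y)" if "y \<in> T" for y
    using that assms(2) by (intro segre_eq_hpoint) auto
  then have eq: "segre k n ` T = (\<lambda>y. hpoint (segre_rep k n y)) ` T"
    by (rule image_cong[OF refl])
  have "inj_on (segre k n) T" using segre_inj_on assms(2) by (rule inj_on_subset)
  then have "inj_on (\<lambda>y. hpoint (segre_rep k n y)) T"
    by (simp add: inj_on_def eqy)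
  then show ?thesis
    unfolding segre_independent_def eq
    using assms segre_rep_nonzero by (intro proj_independent_iff) auto
qed

locale segre_circuit = segre_relation +
  assumes proper_independent: "T \<subset> S \<Longrightarrow> lin_indep_on T (segre_rep k n)"
    and S_nonempty: "S \<noteq> {}"

text \<open>A vanishing coefficient would leave a nontrivial relation on a proper subset, so every
  coefficient of a nontrivial relation on a circuit is nonzero.\<close>

lemma segre_circuit_of_circuit:
  assumes S: "finite S" "S \<subseteq> multiproj k n" "S \<noteq> {}" and circ: "circuit k n S"
  obtains c where "segre_circuit k n S c"
proof -
  have "\<not> lin_indep_on S (segre_rep k n)"
    using circ segre_independent_iff[OF S(1,2)] by (simp add: circuit_def)
  then obtain c y where c: "\<And>J. (\<Sum>y\<in>S. c y * segre_rep k n y J) = 0" "y \<in> S" "c y \<noteq> 0"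
    unfolding lin_indep_on_def by blast
  have proper: "lin_indep_on T (segre_rep k n)" if "T \<subset> S" for T
  proof -
    have "finite T" "T \<subseteq> multiproj k n" using that S finite_subset by auto
    with that show ?thesis using circ segre_independent_iff[of T k n] by (auto simp: circuit_def)
  qed
  have "c z \<noteq> 0" if "z \<in> S" for z
  proof
    assume "c z = 0"
    have "(\<Sum>y\<in>S - {z}. c y * segre_rep k n y J) = 0" for J
      using c(1)[of J] \<open>c z = 0\<close> S(1) that by (simp add: sum.remove[of S z])
    moreover have "S - {z} \<subset> S" "y \<in> S - {z}" using that c \<open>c z = 0\<close> by auto
    ultimately show False using lin_indep_onD[OF proper] c(3) by blast
  qed
  then have "segre_circuit k n S c" using S c proper by unfold_locales auto
  then show thesis by (rule that)
qed

section \<open>Linear spans and nondegeneracy in terms of representatives\<close>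

lemma proj_of_subspace_inject:
  assumes "vec.subspace V" "vec.subspace W" "proj_of V = proj_of W"
  shows "V = W"
proof -
  have *: "V \<subseteq> W" if sub: "vec.subspace W" and eq: "proj_of V = proj_of W"
    for V W :: "('b \<Rightarrow> 'c :: field) set"
  proof
    fix v assume "v \<in> V"
    show "v \<in> W"
    proof (cases "v = 0")
      case True
      then show ?thesis using sub by (simp add: vec.subspace_0)
    next
      case False
      then have "hpoint v \<in> proj_of W" using \<open>v \<in> V\<close> eq by (auto simp: proj_of_def)
      then obtain w where w: "w \<in> W" "hpoint v = hpoint w" by (auto simp: proj_of_def)
      then have "v \<in> vec.span {w}" using False hpoint_eq_iff by blast
      moreover have "vec.span {w} \<subseteq> W" using w sub by (intro vec.span_minimal) auto
      ultimately show ?thesis by blast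
    qed
  qed
  show ?thesis using *[OF assms(2,3)] *[OF assms(1) assms(3)[symmetric]] by blast
qed

lemma span_Union_hpoint: "vec.span (\<Union>y\<in>T. hpoint (t y)) = vec.span (t ` T)"
proof
  show "vec.span (\<Union>y\<in>T. hpoint (t y)) \<subseteq> vec.span (t ` T)"
    unfolding hpoint_def by (intro vec.span_minimal vec.subspace_span UN_least vec.span_mono) auto
  show "vec.span (t ` T) \<subseteq> vec.span (\<Union>y\<in>T. hpoint (t y))"
    unfolding hpoint_def by (intro vec.span_mono) (auto intro: vec.span_base)
qed

lemma nondegenerate_span:
  assumes "nondegenerate k n S" "S \<subseteq> multiproj k n" "i \<in> {1..k}"
  shows "vec.span ((\<lambda>y. rep y i) ` S) = coord_space {0..n i}"
proof -
  have eq: "\<Union>((\<lambda>y. y i) ` S) = (\<Union>y\<in>S. hpoint (rep y i))"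
    using assms by (intro arg_cong[of _ _ Union] image_cong) (auto simp: hpoint_rep subset_eq)
  have "proj_of (vec.span (\<Union>((\<lambda>y. y i) ` S))) = proj_of (coord_space {0..n i})"
    using assms(1,3) unfolding nondegenerate_def proj_span_def proj_space_def by blast
  then have "proj_of (vec.span ((\<lambda>y. rep y i) ` S)) = proj_of (coord_space {0..n i})"
    by (simp only: eq span_Union_hpoint)
  then show ?thesis
    by (rule proj_of_subspace_inject[OF vec.subspace_span subspace_coord_space])
qed

lemma proj_span_segre:
  assumes "A \<subseteq> multiproj k n"
  shows "proj_span (segre k n ` A) = proj_of (vec.span (segre_rep k n ` A))"
proof -
  have "\<Union>(segre k n ` A) = (\<Union>y\<in>A. hpoint (segre_rep k n y))"
    using assms by (intro arg_cong[of _ _ Union] image_cong[OF refl] segre_eq_hpoint) auto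
  then show ?thesis unfolding proj_span_def by (simp only: span_Union_hpoint)
qed

text \<open>A constant coordinate would make one vector span a space of dimension
  \<open>n i + 1\<close>, which is at least 2.\<close>

lemma not_constant_factor:
  assumes "nondegenerate k n S" "S \<subseteq> multiproj k n" "i \<in> {1..k}" "n i > 0" "e \<in> S"
  shows "\<exists>y\<in>S. y i \<noteq> e i"
proof (rule ccontr)
  assume "\<not> ?thesis"
  then have "(\<lambda>y. rep y i) ` S \<subseteq> vec.span {rep e i}"
    using assms rep_in_span_singleton_iff[OF _ _ assms(3), of _ n e] by blast
  then have "vec.span ((\<lambda>y. rep y i) ` S) \<subseteq> vec.span {rep e i}"
    by (intro vec.span_minimal vec.subspace_span)
  then have "vec.dim (coord_space {0..n i} :: (nat \<Rightarrow> 'a) set) \<le> card {rep e i}"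
    unfolding nondegenerate_span[OF assms(1-3)] by (rule vec.dim_le_card) simp
  then show False using assms(4) by (simp add: dim_coord_space)
qed

lemma card_four_obtain_rest:
  assumes "card S = 4" "{a, b} \<subseteq> S" "a \<noteq> b"
  obtains d e where "S = {a, b, d, e}" "a \<noteq> d" "a \<noteq> e" "b \<noteq> d" "b \<noteq> e" "d \<noteq> e"
proof -
  have "finite S" using assms(1) card.infinite by fastforce
  then have "card (S - {a, b}) = 2" using assms by (simp add: card_Diff_subset)
  then obtain d e where "S - {a, b} = {d, e}" "d \<noteq> e" by (auto simp: card_2_iff)
  then show thesis using assms(2) by (intro that[of d e]) blast+
qed

section \<open>Four points: bounds on the dimensions and the number of factors\<close>

locale nondegenerate_relation = segre_relation +
  assumes nondeg: "nondegenerate k n S" and n_pos: "i \<in> {1..k} \<Longrightarrow> n i > 0"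
    and card_S: "card S = 4"
begin

text \<open>A coordinate shared by three points is shared by the fourth, against
  nondegeneracy.\<close>

lemma no_three_equal:
  assumes "S = {a, b, d, e}" "a \<noteq> b" "a \<noteq> d" "a \<noteq> e" "i \<in> {1..k}" "b i = d i"
  shows "b i \<noteq> e i"
proof
  assume "b i = e i"
  then have "a i = b i" using three_equal_imp_all_equal[of a b d e i] assms by blast
  then have "\<forall>y\<in>S. y i = b i" using assms \<open>b i = e i\<close> by auto
  then show False using not_constant_factor[OF nondeg S_sub assms(5) n_pos[OF assms(5)], of b] assms by auto
qed

text \<open>\<open>a\<close> cannot share the coordinate of \<open>b\<close> and \<open>d\<close> on
  \<open>i\<close>, since that would make three equal ones; the only alternative left is agreement
  with \<open>e\<close> on \<open>j\<close>.\<close>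

lemma opposite_equal:
  assumes "S = {a, b, d, e}" "a \<noteq> b" "a \<noteq> d" "a \<noteq> e" "b \<noteq> d" "b \<noteq> e" "d \<noteq> e"
    and "i \<in> {1..k}" "j \<in> {1..k}" "i \<noteq> j" "b i = d i"
  shows "a j = e j"
proof -
  have "S = {e, b, d, a}" using assms(1) by auto
  then have "b i \<noteq> a i" using no_three_equal[of e b d a i] assms by auto
  then show ?thesis using equal_factors_cases[of a b d e i j] assms by auto
qed

text \<open>If \<open>n i\<close> were at least 2, three points would have independent coordinates
  on \<open>i\<close>. For \<open>a\<close> among them, assign the other two to \<open>i\<close> and
  the remaining point \<open>e\<close> to \<open>j\<close>: the span condition fails on
  \<open>i\<close>, so \<open>a\<close> agrees with \<open>e\<close> on \<open>j\<close>. Then the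
  factor \<open>j\<close> is constant on \<open>S\<close>, against nondegeneracy.\<close>

lemma dim_factor:
  assumes ij: "i \<in> {1..k}" "j \<in> {1..k}" "i \<noteq> j"
  shows "n i = 1"
proof (rule ccontr)
  assume "n i \<noteq> 1"
  with n_pos[OF ij(1)] have ge: "n i \<ge> 2" by linarith
  let ?r = "\<lambda>y. rep y i"
  obtain B where B: "B \<subseteq> ?r ` S" "vec.independent B" "?r ` S \<subseteq> vec.span B"
    using vec.maximal_independent_subset[of "?r ` S"] by blast
  have "coord_space {0..n i} \<subseteq> vec.span B"
    unfolding nondegenerate_span[OF nondeg S_sub ij(1), symmetric]
    using B(3) by (intro vec.span_minimal vec.subspace_span)
  moreover have "B \<subseteq> coord_space {0..n i}"
    using B(1) S_sub ij(1) rep_coord_space by blast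
  ultimately have "card B = n i + 1"
    using vec.basis_card_eq_dim[of B] B(2) by (simp add: dim_coord_space)
  then obtain C where C: "C \<subseteq> B" "card C = 3" using ge obtain_subset_with_card_n[of 3 B] by auto
  then have indC: "vec.independent C" using B(2) vec.independent_mono by blast
  obtain T where T: "T \<subseteq> S" "inj_on ?r T" "C = ?r ` T"
    using order_trans[OF C(1) B(1)] unfolding subset_image_inj by blast
  have "card T = 3" using T C(2) by (simp add: card_image)
  then have "card (S - T) = 1"
    using card_Diff_subset[OF finite_subset[OF T(1) finite_S] T(1)] card_S by simp
  then obtain e where e: "S - T = {e}" by (auto simp: card_1_singleton_iff)
  have eq: "a j = e j" if a: "a \<in> T" for a
  proof -
    define g where "g x = (if x = e then j else i)" for x :: "nat \<Rightarrow> (nat \<Rightarrow> 'a) set"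
    have "a \<in> S" "a \<noteq> e" "e \<in> S" using a e T by auto
    have i_set: "{z \<in> S - {a}. g z = i} = T - {a}" using e ij T by (auto simp: g_def)
    have j_set: "{z \<in> S - {a}. g z = j} = {e}" using e ij \<open>a \<noteq> e\<close> by (auto simp: g_def)
    have "?r ` (T - {a}) = C - {?r a}"
      using inj_on_image_set_diff[OF T(2), of T "{a}"] a T(3) by auto
    moreover have "?r a \<in> C" using a T(3) by blast
    then have "?r a \<notin> vec.span (C - {?r a})"
      using indC unfolding vec.dependent_def by blast
    ultimately have not_i: "rep a i \<notin> vec.span ((\<lambda>z. rep z i) ` {z \<in> S - {a}. g z = i})"
      unfolding i_set by (simp only: not_False_eq_True)
    have "\<exists>l\<in>g ` (S - {a}). rep a l \<in> vec.span ((\<lambda>z. rep z l) ` {z \<in> S - {a}. g z = l})"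
      by (rule in_span_of_assigned) (use ij \<open>a \<in> S\<close> in \<open>auto simp: g_def\<close>)
    moreover have "g ` (S - {a}) \<subseteq> {i, j}" by (auto simp: g_def)
    ultimately have "rep a j \<in> vec.span ((\<lambda>z. rep z j) ` {z \<in> S - {a}. g z = j})"
      using not_i by blast
    then have "rep a j \<in> vec.span ((\<lambda>z. rep z j) ` {e})" unfolding j_set .
    then show ?thesis using rep_in_span_singleton[OF \<open>a \<in> S\<close> \<open>e \<in> S\<close> ij(2)] by simp
  qed
  have "y j = e j" if "y \<in> S" for y
    using eq[of y] e that by (cases "y \<in> T") auto
  moreover have "e \<in> S" using e by blast
  ultimately show False using not_constant_factor[OF nondeg S_sub ij(2) n_pos[OF ij(2)]] by blast
qed

text \<open>Suppose there are at least three factors. If \<open>b\<close> and \<open>d\<close> agree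
  on \<open>i\<close>, the other two points agree on each factor \<open>j\<close> other than
  \<open>i\<close>, and this in turn makes \<open>b\<close> and \<open>d\<close> agree on each
  factor other than \<open>j\<close>. Varying \<open>j\<close> gives \<open>b = d\<close>. So
  distinct points differ on every factor, which contradicts the assignment of one point to each of
  three factors.\<close>

lemma at_most_two_factors: "k \<le> 2"
proof (rule ccontr)
  assume "\<not> k \<le> 2"
  then have k: "1 \<in> {1..k}" "2 \<in> {1..k}" "3 \<in> {1..k}" by auto
  have no_eq: "b i \<noteq> d i" if bd: "b \<in> S" "d \<in> S" "b \<noteq> d" and i: "i \<in> {1..k}" for b d i
  proof
    assume eq: "b i = d i"
    obtain a e where S: "S = {b, d, a, e}" "b \<noteq> a" "b \<noteq> e" "d \<noteq> a" "d \<noteq> e" "a \<noteq> e"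
      using card_four_obtain_rest[of S b d] card_S bd by auto
    have opp: "a j = e j" if "j \<in> {1..k}" "j \<noteq> i" for j
      using opposite_equal[of a b d e i j] that S i eq bd(3) by blast
    have opp2: "b l = d l" if "j \<in> {1..k}" "l \<in> {1..k}" "j \<noteq> i" "l \<noteq> j" for j l
      using opposite_equal[of b a e d j l] opp[of j] that S bd(3) by blast
    have "b l = d l" if l: "l \<in> {1..k}" for l
    proof -
      \<comment> \<open>Here a third factor is indispensable: \<open>j\<close> must avoid both
        \<open>i\<close> and \<open>l\<close>.\<close>
      have "\<exists>j\<in>{1, 2, 3}. j \<noteq> i \<and> j \<noteq> l" by simp arith
      then obtain j where "j \<in> {1..k}" "j \<noteq> i" "j \<noteq> l" using k by blast
      then show ?thesis using opp2 l by blast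
    qed
    then show False using multiproj_eqI[of b k n d] bd S_sub by blast
  qed
  obtain a where "a \<in> S" using card_S by fastforce
  then have "\<not> S \<subseteq> {a}" using card_S card_mono[of "{a}" S] by auto
  then obtain b where "b \<in> S" "a \<noteq> b" by blast
  then obtain d e where S: "S = {a, b, d, e}" "a \<noteq> d" "a \<noteq> e" "b \<noteq> d" "b \<noteq> e" "d \<noteq> e"
    using card_four_obtain_rest[of S a b] card_S \<open>a \<in> S\<close> by auto
  then show False
    using equal_in_some_of_three[of a b d e 1 2 3] k no_eq[of a b 1] no_eq[of a d 2] no_eq[of a e 3]
      \<open>a \<noteq> b\<close> by auto
qed

end

section \<open>Secant lines of the Segre variety\<close>

text \<open>Subtracting the multiple of \<open>c\<close> that cancels the coefficient at
  \<open>z\<close> leaves a relation on a proper subset, which is trivial.\<close>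

lemma (in segre_circuit) relation_unique:
  assumes e: "\<And>J. (\<Sum>y\<in>S. e y * segre_rep k n y J) = 0"
  shows "\<exists>r. \<forall>y\<in>S. e y = r * c y"
proof -
  obtain z where z: "z \<in> S" using S_nonempty by blast
  define r where "r = e z / c z"
  have ez: "e z = r * c z" using c_nonzero[OF z] by (simp add: r_def)
  have "(\<Sum>y\<in>S - {z}. (e y - r * c y) * segre_rep k n y J) = 0" for J
  proof -
    have "0 = (\<Sum>y\<in>S. e y * segre_rep k n y J) - r * (\<Sum>y\<in>S. c y * segre_rep k n y J)"
      by (simp add: e relation)
    also have "\<dots> = (\<Sum>y\<in>S. (e y - r * c y) * segre_rep k n y J)"
      by (simp add: sum_distrib_left sum_subtractf algebra_simps)
    also have "\<dots> = (\<Sum>y\<in>S - {z}. (e y - r * c y) * segre_rep k n y J)"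
      using finite_S z ez by (simp add: sum.remove[of S z])
    finally show ?thesis by simp
  qed
  then have "e y - r * c y = 0" if "y \<in> S - {z}" for y
    using lin_indep_onD[OF proper_independent, of "S - {z}" "\<lambda>y. e y - r * c y" y] z that by blast
  then have "\<forall>y\<in>S. e y = r * c y" using ez by (metis DiffI eq_iff_diff_eq_0 singletonD)
  then show ?thesis by blast
qed

text \<open>When \<open>c\<close> is a relation on \<open>S\<close>, this is minus the sum over
  \<open>S - A\<close>, hence a common vector of the two spans.\<close>

definition partial_sum ::
  "nat \<Rightarrow> (nat \<Rightarrow> nat) \<Rightarrow> ((nat \<Rightarrow> (nat \<Rightarrow> 'a) set) \<Rightarrow> 'a) \<Rightarrow> (nat \<Rightarrow> (nat \<Rightarrow> 'a :: field) set) set \<Rightarrow>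
    (nat \<Rightarrow> nat) \<Rightarrow> 'a" where
  "partial_sum k n c A = (\<lambda>J. \<Sum>y\<in>A. c y * segre_rep k n y J)"

lemma (in segre_circuit) partial_sum_nonzero:
  assumes "A \<subset> S" "A \<noteq> {}"
  shows "partial_sum k n c A \<noteq> 0"
proof
  assume "partial_sum k n c A = 0"
  then have "(\<Sum>y\<in>A. c y * segre_rep k n y J) = 0" for J
    by (metis partial_sum_def zero_fun_apply)
  then have "\<forall>y\<in>A. c y = 0" using lin_indep_onD[OF proper_independent[OF assms(1)]] by blast
  then show False using assms c_nonzero by blast
qed

text \<open>Equating two expansions of a common vector, one over \<open>A\<close> and one over
  \<open>S - A\<close>, gives a relation on \<open>S\<close>. It is a multiple of \<open>c\<close>,
  so the vector is a multiple of the partial sum.\<close>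

lemma (in segre_circuit) spans_meet:
  assumes A: "A \<subset> S" "A \<noteq> {}"
  shows "proj_span (segre k n ` A) \<inter> proj_span (segre k n ` (S - A)) = {hpoint (partial_sum k n c A)}"
proof -
  let ?q = "partial_sum k n c A"
  have fin: "finite A" "finite (S - A)" using A finite_S finite_subset by auto
  have sub: "A \<subseteq> multiproj k n" "S - A \<subseteq> multiproj k n" using A S_sub by auto
  have split: "(\<Sum>y\<in>S. f y) = (\<Sum>y\<in>A. f y) + (\<Sum>y\<in>S - A. f y)" for f :: "_ \<Rightarrow> 'a"
    using A finite_S by (metis add.commute psubset_imp_subset sum.subset_diff)
  have qA: "?q \<in> vec.span (segre_rep k n ` A)"
    unfolding span_family_iff[OF fin(1)] by (rule exI[of _ c]) (rule partial_sum_def)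
  have qSA: "?q \<in> vec.span (segre_rep k n ` (S - A))"
  proof -
    have "?q = (\<lambda>J. \<Sum>y\<in>S - A. - c y * segre_rep k n y J)"
    proof
      fix J
      show "?q J = (\<Sum>y\<in>S - A. - c y * segre_rep k n y J)"
        using relation[of J] split[of "\<lambda>y. c y * segre_rep k n y J"]
        by (simp add: partial_sum_def sum_negf eq_neg_iff_add_eq_0)
    qed
    then show ?thesis
      unfolding span_family_iff[OF fin(2)] by (intro exI[of _ "\<lambda>y. - c y"])
  qed
  have nz: "?q \<noteq> 0" using partial_sum_nonzero[OF A] .
  have "p = hpoint ?q"
    if p: "p \<in> proj_of (vec.span (segre_rep k n ` A))" "p \<in> proj_of (vec.span (segre_rep k n ` (S - A)))"
    for p
  proof -
    obtain v where v: "v \<in> vec.span (segre_rep k n ` A)" "v \<noteq> 0" "p = hpoint v"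
      using p(1) by (auto simp: proj_of_def)
    obtain w where w: "w \<in> vec.span (segre_rep k n ` (S - A))" "w \<noteq> 0" "p = hpoint w"
      using p(2) by (auto simp: proj_of_def)
    have "v \<in> vec.span {w}" using hpoint_eq_iff[of v w] v w by simp
    moreover have "vec.span {w} \<subseteq> vec.span (segre_rep k n ` (S - A))"
      using w by (intro vec.span_minimal vec.subspace_span) auto
    ultimately have "v \<in> vec.span (segre_rep k n ` (S - A))" by blast
    then obtain \<beta> where \<beta>: "v = (\<lambda>J. \<Sum>y\<in>S - A. \<beta> y * segre_rep k n y J)"
      unfolding span_family_iff[OF fin(2)] by blast
    obtain \<alpha> where \<alpha>: "v = (\<lambda>J. \<Sum>y\<in>A. \<alpha> y * segre_rep k n y J)"
      using v(1) unfolding span_family_iff[OF fin(1)] by blast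
    define e where "e y = (if y \<in> A then \<alpha> y else - \<beta> y)" for y
    have "(\<Sum>y\<in>S. e y * segre_rep k n y J) = 0" for J
    proof -
      have "(\<Sum>y\<in>S. e y * segre_rep k n y J) =
        (\<Sum>y\<in>A. \<alpha> y * segre_rep k n y J) + (\<Sum>y\<in>S - A. - \<beta> y * segre_rep k n y J)"
        unfolding split by (intro arg_cong2[of _ _ _ _ "(+)"] sum.cong) (auto simp: e_def)
      also have "\<dots> = v J - v J" unfolding fun_cong[OF \<alpha>, of J, symmetric]
        by (subst fun_cong[OF \<beta>, of J]) (simp add: sum_negf)
      finally show ?thesis by simp
    qed
    then obtain r where r: "\<And>y. y \<in> S \<Longrightarrow> e y = r * c y" using relation_unique by blast
    have v_eq: "v = (\<lambda>J. r * ?q J)"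
    proof
      fix J
      have "v J = (\<Sum>y\<in>A. \<alpha> y * segre_rep k n y J)" using \<alpha> by (rule fun_cong)
      also have "\<dots> = (\<Sum>y\<in>A. r * (c y * segre_rep k n y J))"
      proof (rule sum.cong[OF refl])
        fix y assume "y \<in> A"
        then have "\<alpha> y = r * c y" using r[of y] A by (auto simp: e_def)
        then show "\<alpha> y * segre_rep k n y J = r * (c y * segre_rep k n y J)" by (simp add: mult.assoc)
      qed
      finally show "v J = r * ?q J" by (simp add: partial_sum_def sum_distrib_left)
    qed
    have "r \<noteq> 0" using v(2) unfolding v_eq by (auto simp: fun_eq_iff)
    then show ?thesis unfolding v(3) v_eq by (rule hpoint_scale)
  qed
  moreover have "hpoint ?q \<in> proj_of (vec.span (segre_rep k n ` A))"
    "hpoint ?q \<in> proj_of (vec.span (segre_rep k n ` (S - A)))"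
    using qA qSA nz by (auto simp: proj_of_def)
  ultimately show ?thesis
    unfolding proj_span_segre[OF sub(1)] proj_span_segre[OF sub(2)] by blast
qed

text \<open>
  A third point \<open>z\<close> of the Segre variety on the line through \<open>a\<close> and \<open>b\<close> would have to agree
  with \<open>a\<close> on both factors \<open>i\<close> and \<open>j\<close>, hence everywhere.
\<close>

lemma partial_sum_pair_not_on_segre:
  fixes a b z :: "nat \<Rightarrow> (nat \<Rightarrow> 'a :: field) set"
  assumes abz: "a \<in> multiproj k n" "b \<in> multiproj k n" "z \<in> multiproj k n"
    and ij: "i \<in> {1..k}" "j \<in> {1..k}" "i \<noteq> j" "a i \<noteq> b i" "a j \<noteq> b j"
    and c: "c a \<noteq> 0" "c b \<noteq> 0"
  shows "partial_sum k n c {a, b} \<notin> vec.span {segre_rep k n z}"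
proof
  assume "partial_sum k n c {a, b} \<in> vec.span {segre_rep k n z}"
  then obtain r where "partial_sum k n c {a, b} = (\<lambda>J. r * segre_rep k n z J)"
    by (auto simp: vec.span_singleton)
  moreover have "a \<noteq> b" using ij by auto
  ultimately have eq: "c a * segre_rep k n a J + c b * segre_rep k n b J = r * segre_rep k n z J" for J
    unfolding partial_sum_def by (simp add: fun_eq_iff)
  have no_pair: False if "c' a \<noteq> 0" "c' b \<noteq> 0"
    "\<And>J. c' a * segre_rep k n a J + c' b * segre_rep k n b J = 0" for c'
  proof -
    interpret segre_relation k n "{a, b}" c'
      using that abz \<open>a \<noteq> b\<close> by unfold_locales auto
    have "{y \<in> {a, b} - {a}. i = i} = {b}" using \<open>a \<noteq> b\<close> by auto
    then have "rep a i \<in> vec.span {rep b i}"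
      using in_span_of_assigned[of a "\<lambda>_. i"] ij by auto
    then show False using ij rep_in_span_singleton[of a b i] by simp
  qed
  have single: False if "x \<in> multiproj k n" "s \<noteq> 0" "\<And>J. s * segre_rep k n x J = 0" for x s
    using segre_rep_nonzero[OF that(1)] that(2,3) by (simp add: fun_eq_iff)
  \<comment> \<open>If \<open>z\<close> is \<open>a\<close> or \<open>b\<close>, its term merges
    with the term of that point. The merged coefficient may vanish, which leaves a relation on a
    single point.\<close>
  consider "r = 0" | "z = a" "r \<noteq> 0" | "z = b" "r \<noteq> 0" | "z \<noteq> a" "z \<noteq> b" "r \<noteq> 0" by blast
  then show False
  proof cases
    case 1
    then show False using no_pair[of c] c eq by simp
  next
    case 2
    show False
    proof (cases "c a = r")
      case True
      then show False using single[OF abz(2) c(2)] eq 2 by simp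
    next
      case False
      have "(c a - r) * segre_rep k n a J + c b * segre_rep k n b J = 0" for J
        using eq[of J] 2 by (simp add: algebra_simps)
      then show False using no_pair[of "c(a := c a - r)"] c False \<open>a \<noteq> b\<close> by simp
    qed
  next
    case 3
    show False
    proof (cases "c b = r")
      case True
      then show False using single[OF abz(1) c(1)] eq 3 by simp
    next
      case False
      have "c a * segre_rep k n a J + (c b - r) * segre_rep k n b J = 0" for J
        using eq[of J] 3 by (simp add: algebra_simps)
      then show False using no_pair[of "c(b := c b - r)"] c False \<open>a \<noteq> b\<close> by simp
    qed
  next
    case 4
    let ?c = "c(z := - r)"
    have "(\<Sum>y\<in>{a, b, z}. ?c y * segre_rep k n y J) = 0" for J
      using eq[of J] 4 \<open>a \<noteq> b\<close> by (simp add: algebra_simps)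
    then interpret segre_relation k n "{a, b, z}" ?c
      using abz c 4 by unfold_locales auto
    have agree: "a m = z m" if lm: "l \<in> {1..k}" "m \<in> {1..k}" "l \<noteq> m" "a l \<noteq> b l" for l m
    proof -
      define g where "g x = (if x = b then l else m)" for x :: "nat \<Rightarrow> (nat \<Rightarrow> 'a) set"
      have "\<exists>i\<in>g ` ({a, b, z} - {a}).
          rep a i \<in> vec.span ((\<lambda>y. rep y i) ` {y \<in> {a, b, z} - {a}. g y = i})"
        by (rule in_span_of_assigned) (use lm in \<open>auto simp: g_def\<close>)
      moreover have "g ` ({a, b, z} - {a}) \<subseteq> {l, m}" by (auto simp: g_def)
      moreover have l_set: "{y \<in> {a, b, z} - {a}. g y = l} = {b}"
        using lm 4 \<open>a \<noteq> b\<close> by (auto simp: g_def)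
      have "rep a l \<notin> vec.span ((\<lambda>y. rep y l) ` {y \<in> {a, b, z} - {a}. g y = l})"
        unfolding l_set using rep_in_span_singleton[of a b l] lm by simp
      moreover have m_set: "{y \<in> {a, b, z} - {a}. g y = m} = {z}"
        using lm 4 \<open>a \<noteq> b\<close> by (auto simp: g_def)
      ultimately have "rep a m \<in> vec.span ((\<lambda>y. rep y m) ` {y \<in> {a, b, z} - {a}. g y = m})"
        by blast
      then have "rep a m \<in> vec.span {rep z m}" unfolding m_set by simp
      then show ?thesis using rep_in_span_singleton[of a z m] lm by simp
    qed
    \<comment> \<open>For \<open>m\<close> other than \<open>i\<close>, assign \<open>b\<close> to
      \<open>i\<close>; for \<open>m = i\<close>, assign \<open>b\<close> to
      \<open>j\<close>.\<close>
    have "a m = z m" if "m \<in> {1..k}" for m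
      using agree[of i m] agree[of j m] ij that by (cases "m = i") auto
    then show False using multiproj_eqI[OF abz(1,3)] 4 by blast
  qed
qed

text \<open>The empty set spans no point, and a single point of the Segre variety is excluded by
  \<open>partial_sum_pair_not_on_segre\<close>. The images of \<open>a\<close> and \<open>b\<close>
  are two distinct points and attain the bound.\<close>

lemma X_rank_partial_sum_pair:
  fixes a b :: "nat \<Rightarrow> (nat \<Rightarrow> 'a :: field) set"
  assumes ab: "a \<in> multiproj k n" "b \<in> multiproj k n"
    and ij: "i \<in> {1..k}" "j \<in> {1..k}" "i \<noteq> j" "a i \<noteq> b i" "a j \<noteq> b j"
    and c: "c a \<noteq> 0" "c b \<noteq> 0"
    and q: "hpoint (partial_sum k n c {a, b}) \<in> proj_span (segre k n ` {a, b})"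
  shows "X_rank k n (hpoint (partial_sum k n c {a, b})) = 2"
  unfolding X_rank_def
proof (rule Least_equality)
  let ?q = "partial_sum k n c {a, b}"
  have "a \<noteq> b" using ij by auto
  then have "segre k n a \<noteq> segre k n b" using segre_inj_on ab by (auto dest: inj_onD)
  then show "\<exists>B\<subseteq>segre_variety k n. finite B \<and> card B = 2 \<and> hpoint ?q \<in> proj_span B"
    using ab q by (intro exI[of _ "segre k n ` {a, b}"]) (auto simp: segre_variety_def)
  fix m
  assume "\<exists>B\<subseteq>segre_variety k n. finite B \<and> card B = m \<and> hpoint ?q \<in> proj_span B"
  then obtain B where B: "B \<subseteq> segre_variety k n" "finite B" "card B = m" "hpoint ?q \<in> proj_span B"
    by blast
  show "2 \<le> m"
  proof (rule ccontr)
    assume "\<not> 2 \<le> m"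
    then consider "m = 0" | "m = 1" by linarith
    then show False
    proof cases
      case 1
      then have "B = {}" using B by simp
      then show False using B(4) by (simp add: proj_span_def proj_of_def)
    next
      case 2
      then obtain x where "B = {x}" using B card_1_singletonE by blast
      then obtain z where z: "z \<in> multiproj k n" "B = segre k n ` {z}"
        using B(1) by (auto simp: segre_variety_def)
      have "hpoint ?q \<in> proj_of (vec.span (segre_rep k n ` {z}))"
        using B(4) unfolding z(2) using proj_span_segre[of "{z}" k n] z(1) by simp
      then obtain v where v: "v \<in> vec.span {segre_rep k n z}" "v \<noteq> 0" "hpoint ?q = hpoint v"
        by (auto simp: proj_of_def)
      have "?q \<in> hpoint ?q" by (simp add: hpoint_def vec.span_base)
      then have "?q \<in> vec.span {v}" using v(3) by (simp add: hpoint_def)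
      moreover have "vec.span {v} \<subseteq> vec.span {segre_rep k n z}"
        using v(1) by (intro vec.span_minimal vec.subspace_span) auto
      ultimately show False
        using partial_sum_pair_not_on_segre[OF ab z(1) ij c] by blast
    qed
  qed
qed

text \<open>The rank is computed from the pair \<open>{a, b}\<close>. The complementary pair then
  computes it as well, because it has two elements and \<open>q\<close> lies in its span.\<close>

lemma (in segre_circuit) complementary_secants:
  assumes S: "S = {a, b, d, e}" and card_S: "card S = 4"
    and ij: "i \<in> {1..k}" "j \<in> {1..k}" "i \<noteq> j" "a i \<noteq> b i" "a j \<noteq> b j"
  shows "\<exists>q. proj_span (segre k n ` {a, b}) \<inter> proj_span (segre k n ` (S - {a, b})) = {q} \<and>
    X_rank k n q = 2 \<and> {a, b} \<in> rank_sets k n q \<and> S - {a, b} \<in> rank_sets k n q"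
proof -
  have "a \<noteq> b" using ij by auto
  then have card2: "card {a, b} = 2" by simp
  then have "{a, b} \<noteq> S" using card_S by auto
  then have A: "{a, b} \<subset> S" using S by blast
  have card_rest: "card (S - {a, b}) = 2"
    using card_Diff_subset[of "{a, b}" S] A card2 card_S by auto
  let ?q = "hpoint (partial_sum k n c {a, b})"
  have meet: "proj_span (segre k n ` {a, b}) \<inter> proj_span (segre k n ` (S - {a, b})) = {?q}"
    by (rule spans_meet[OF A]) simp
  then have in1: "?q \<in> proj_span (segre k n ` {a, b})"
    and in2: "?q \<in> proj_span (segre k n ` (S - {a, b}))" by blast+
  have ab: "a \<in> S" "b \<in> S" using S by auto
  have rank: "X_rank k n ?q = 2"
    using X_rank_partial_sum_pair[OF _ _ ij _ _ in1] ab S_sub c_nonzero by blast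
  have "{a, b} \<in> rank_sets k n ?q" "S - {a, b} \<in> rank_sets k n ?q"
    using ab S_sub in1 in2 rank card2 card_rest finite_S by (auto simp: rank_sets_def)
  with meet rank show ?thesis by blast
qed

section \<open>Multihomogeneous polynomials\<close>

definition mon_eval :: "(nat \<Rightarrow> nat \<Rightarrow> 'a :: field) \<Rightarrow> (nat \<times> nat \<Rightarrow>\<^sub>0 nat) \<Rightarrow> 'a" where
  "mon_eval v m = (\<Prod>(i, j)\<in>Poly_Mapping.keys m. v i j ^ Poly_Mapping.lookup m (i, j))"

lemma mon_eval_superset:
  assumes "finite X" "Poly_Mapping.keys m \<subseteq> X"
  shows "mon_eval v m = (\<Prod>(i, j)\<in>X. v i j ^ Poly_Mapping.lookup m (i, j))"
  unfolding mon_eval_def using assms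
  by (intro prod.mono_neutral_left) (auto simp: in_keys_iff)

lemma mon_eval_add: "mon_eval v (m + m') = mon_eval v m * mon_eval v m'"
proof -
  let ?X = "Poly_Mapping.keys m \<union> Poly_Mapping.keys m'"
  have "mon_eval v (m + m') = (\<Prod>(i, j)\<in>?X. v i j ^ Poly_Mapping.lookup (m + m') (i, j))"
    by (intro mon_eval_superset Poly_Mapping.keys_add) simp
  also have "\<dots> = (\<Prod>(i, j)\<in>?X. v i j ^ Poly_Mapping.lookup m (i, j)) *
      (\<Prod>(i, j)\<in>?X. v i j ^ Poly_Mapping.lookup m' (i, j))"
    unfolding prod.distrib[symmetric] by (intro prod.cong) (auto simp: lookup_add power_add)
  also have "\<dots> = mon_eval v m * mon_eval v m'"
    using mon_eval_superset[of ?X m v] mon_eval_superset[of ?X m' v] by simp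
  finally show ?thesis .
qed

lemma mon_eval_0: "mon_eval v 0 = 1"
  by (simp add: mon_eval_def)

lemma mon_eval_sum: "mon_eval v (\<Sum>i\<in>I. m i) = (\<Prod>i\<in>I. mon_eval v (m i))"
  by (induction I rule: infinite_finite_induct) (simp_all add: mon_eval_0 mon_eval_add)

lemma mon_eval_single: "mon_eval v (Poly_Mapping.single (i, j) e) = v i j ^ e"
  by (simp add: mon_eval_def)

lemma mpoly_eval_superset:
  assumes "finite M" "Poly_Mapping.keys f \<subseteq> M"
  shows "mpoly_eval f v = (\<Sum>m\<in>M. Poly_Mapping.lookup f m * mon_eval v m)"
  unfolding mpoly_eval_def mon_eval_def[symmetric] using assms
  by (intro sum.mono_neutral_left) (auto simp: in_keys_iff)

lemma mpoly_eval_add: "mpoly_eval (f + g) v = mpoly_eval f v + mpoly_eval g v"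
proof -
  let ?M = "Poly_Mapping.keys f \<union> Poly_Mapping.keys g"
  have "mpoly_eval (f + g) v = (\<Sum>m\<in>?M. Poly_Mapping.lookup (f + g) m * mon_eval v m)"
    by (intro mpoly_eval_superset Poly_Mapping.keys_add) simp
  also have "\<dots> = (\<Sum>m\<in>?M. Poly_Mapping.lookup f m * mon_eval v m) +
      (\<Sum>m\<in>?M. Poly_Mapping.lookup g m * mon_eval v m)"
    by (simp add: lookup_add distrib_right sum.distrib)
  also have "\<dots> = mpoly_eval f v + mpoly_eval g v"
    using mpoly_eval_superset[of ?M f v] mpoly_eval_superset[of ?M g v] by simp
  finally show ?thesis .
qed

lemma mpoly_eval_0: "mpoly_eval 0 v = 0"
  by (simp add: mpoly_eval_def)

lemma mpoly_eval_sum: "mpoly_eval (\<Sum>i\<in>I. f i) v = (\<Sum>i\<in>I. mpoly_eval (f i) v)"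
  by (induction I rule: infinite_finite_induct) (simp_all add: mpoly_eval_0 mpoly_eval_add)

lemma mpoly_eval_single: "mpoly_eval (Poly_Mapping.single m c) v = c * mon_eval v m"
  using mpoly_eval_superset[of "{m}" "Poly_Mapping.single m c" v] by simp

lemma poly_mapping_sum_singles:
  "f = (\<Sum>m\<in>Poly_Mapping.keys f. Poly_Mapping.single m (Poly_Mapping.lookup f m))"
  by (rule poly_mapping_eqI) (auto simp: lookup_sum lookup_single when_def in_keys_iff)

lemma mpoly_eval_mult: "mpoly_eval (f * g) v = mpoly_eval f v * mpoly_eval g v"
proof -
  let ?s = "\<lambda>f m. Poly_Mapping.single m (Poly_Mapping.lookup f m)"
  have "f * g = (\<Sum>m\<in>Poly_Mapping.keys f. ?s f m) * (\<Sum>m'\<in>Poly_Mapping.keys g. ?s g m')"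
    by (simp flip: poly_mapping_sum_singles)
  also have "\<dots> = (\<Sum>m\<in>Poly_Mapping.keys f. \<Sum>m'\<in>Poly_Mapping.keys g. ?s f m * ?s g m')"
    by (rule sum_product)
  finally have "mpoly_eval (f * g) v = (\<Sum>m\<in>Poly_Mapping.keys f. \<Sum>m'\<in>Poly_Mapping.keys g.
      (Poly_Mapping.lookup f m * mon_eval v m) * (Poly_Mapping.lookup g m' * mon_eval v m'))"
    by (simp add: mpoly_eval_sum mult_single mpoly_eval_single mon_eval_add ac_simps)
  also have "\<dots> = (\<Sum>m\<in>Poly_Mapping.keys f. Poly_Mapping.lookup f m * mon_eval v m) *
      (\<Sum>m'\<in>Poly_Mapping.keys g. Poly_Mapping.lookup g m' * mon_eval v m')"
    by (rule sum_product[symmetric])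
  finally show ?thesis by (simp add: mpoly_eval_superset[OF _ order_refl])
qed

section \<open>Factors of multihomogeneous polynomials\<close>

lemma leading_part:
  fixes f :: "'m \<Rightarrow>\<^sub>0 'a :: comm_ring_1" and w :: "'m \<Rightarrow> int"
  assumes le: "\<And>m. m \<in> Poly_Mapping.keys f \<Longrightarrow> w m \<le> A"
    and ex: "\<exists>m\<in>Poly_Mapping.keys f. w m = A"
  obtains g h where "f = g + h" "g \<noteq> 0"
    "\<And>m. m \<in> Poly_Mapping.keys g \<Longrightarrow> w m = A" "\<And>m. m \<in> Poly_Mapping.keys h \<Longrightarrow> w m < A"
proof -
  define part where "part P = (\<Sum>m\<in>{m \<in> Poly_Mapping.keys f. P m}. Poly_Mapping.single m (Poly_Mapping.lookup f m))"
    for P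
  have part: "Poly_Mapping.lookup (part P) m = (if P m then Poly_Mapping.lookup f m else 0)" for P m
    by (auto simp: part_def lookup_sum lookup_single when_def in_keys_iff)
  show thesis
  proof (rule that[of "part (\<lambda>m. w m = A)" "part (\<lambda>m. w m \<noteq> A)"])
    show "f = part (\<lambda>m. w m = A) + part (\<lambda>m. w m \<noteq> A)"
      by (rule poly_mapping_eqI) (simp add: lookup_add part)
    show "part (\<lambda>m. w m = A) \<noteq> 0"
    proof
      assume "part (\<lambda>m. w m = A) = 0"
      moreover obtain m where "m \<in> Poly_Mapping.keys f" "w m = A" using ex by blast
      ultimately show False using part[of "\<lambda>m. w m = A" m] by (simp add: in_keys_iff)
    qed
    show "\<And>m. m \<in> Poly_Mapping.keys (part (\<lambda>m. w m = A)) \<Longrightarrow> w m = A"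
      by (auto simp: in_keys_iff part split: if_splits)
    show "\<And>m. m \<in> Poly_Mapping.keys (part (\<lambda>m. w m \<noteq> A)) \<Longrightarrow> w m < A"
      using le by (force simp: in_keys_iff part split: if_splits)
  qed
qed

text \<open>The product of the two leading parts is nonzero of weight \<open>A + B\<close>, and all
  other contributions are lighter, so its monomials cannot cancel. The linear order on exponents
  enters only by making the polynomial ring a domain; for the variables \<open>(i, j)\<close> it
  comes from the lexicographic order on pairs. Weights are integers so that a degree and its
  negative can both be used.\<close>

lemma max_weight_mult:
  fixes f g :: "'m :: {ordered_cancel_comm_monoid_add, linorder} \<Rightarrow>\<^sub>0 'a :: idom"
    and w :: "'m \<Rightarrow> int"
  assumes add: "\<And>m m'. w (m + m') = w m + w m'"
    and nz: "f \<noteq> 0" "g \<noteq> 0"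
  shows "\<exists>m\<in>Poly_Mapping.keys (f * g).
    w m = Max (w ` Poly_Mapping.keys f) + Max (w ` Poly_Mapping.keys g)"
proof -
  define A where "A = Max (w ` Poly_Mapping.keys f)"
  define B where "B = Max (w ` Poly_Mapping.keys g)"
  have ne: "Poly_Mapping.keys f \<noteq> {}" "Poly_Mapping.keys g \<noteq> {}" using nz by auto
  have "\<And>m. m \<in> Poly_Mapping.keys f \<Longrightarrow> w m \<le> A" by (simp add: A_def)
  moreover have "\<exists>m\<in>Poly_Mapping.keys f. w m = A"
  proof -
    have "A \<in> w ` Poly_Mapping.keys f" unfolding A_def using ne(1) by (intro Max_in) simp_all
    then show ?thesis by auto
  qed
  ultimately obtain f1 f2 where f: "f = f1 + f2" "f1 \<noteq> 0"
    "\<And>m. m \<in> Poly_Mapping.keys f1 \<Longrightarrow> w m = A" "\<And>m. m \<in> Poly_Mapping.keys f2 \<Longrightarrow> w m < A"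
    using leading_part[of f w A] by blast
  have "\<And>m. m \<in> Poly_Mapping.keys g \<Longrightarrow> w m \<le> B" by (simp add: B_def)
  moreover have "\<exists>m\<in>Poly_Mapping.keys g. w m = B"
  proof -
    have "B \<in> w ` Poly_Mapping.keys g" unfolding B_def using ne(2) by (intro Max_in) simp_all
    then show ?thesis by auto
  qed
  ultimately obtain g1 g2 where g: "g = g1 + g2" "g1 \<noteq> 0"
    "\<And>m. m \<in> Poly_Mapping.keys g1 \<Longrightarrow> w m = B" "\<And>m. m \<in> Poly_Mapping.keys g2 \<Longrightarrow> w m < B"
    using leading_part[of g w B] by blast
  have "f1 * g1 \<noteq> 0" using f(2) g(2) by simp
  then obtain m where m: "m \<in> Poly_Mapping.keys (f1 * g1)"
    by (metis all_not_in_conv keys_eq_empty)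
  then obtain a b where "m = a + b" "a \<in> Poly_Mapping.keys f1" "b \<in> Poly_Mapping.keys g1"
    using Poly_Mapping.keys_mult[of f1 g1] by blast
  then have wm: "w m = A + B" using f(3) g(3) add by simp
  have "w x < A + B" if x: "x \<in> Poly_Mapping.keys (f1 * g2 + f2 * g)" for x
  proof -
    consider "x \<in> Poly_Mapping.keys (f1 * g2)" | "x \<in> Poly_Mapping.keys (f2 * g)"
      using x Poly_Mapping.keys_add[of "f1 * g2" "f2 * g"] by blast
    then show ?thesis
    proof cases
      case 1
      then obtain a b where "x = a + b" "a \<in> Poly_Mapping.keys f1" "b \<in> Poly_Mapping.keys g2"
        using Poly_Mapping.keys_mult[of f1 g2] by blast
      then show ?thesis using f(3)[of a] g(4)[of b] add by simp
    next
      case 2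
      then obtain a b where ab: "x = a + b" "a \<in> Poly_Mapping.keys f2" "b \<in> Poly_Mapping.keys g"
        using Poly_Mapping.keys_mult[of f2 g] by blast
      then have "w b \<le> B" by (simp add: B_def)
      then show ?thesis using ab f(4)[of a] add by simp
    qed
  qed
  then have "m \<notin> Poly_Mapping.keys (f1 * g2 + f2 * g)" using wm by fastforce
  moreover have "f * g = f1 * g1 + (f1 * g2 + f2 * g)" by (simp add: f(1) g(1) algebra_simps)
  ultimately have "m \<in> Poly_Mapping.keys (f * g)"
    using m by (simp add: in_keys_iff lookup_add)
  then show ?thesis using wm unfolding A_def B_def by blast
qed

text \<open>For the weight and its negative: the largest weights of \<open>f\<close> and
  \<open>g\<close> add up to \<open>d\<close>, and so do the smallest ones. Hence largest and
  smallest weight coincide in each factor.\<close>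

lemma homogeneous_factors:
  fixes f g :: "'m :: {ordered_cancel_comm_monoid_add, linorder} \<Rightarrow>\<^sub>0 'a :: idom"
    and w :: "'m \<Rightarrow> nat"
  assumes add: "\<And>m m'. w (m + m') = w m + w m'" and nz: "f * g \<noteq> 0"
    and hom: "\<And>m. m \<in> Poly_Mapping.keys (f * g) \<Longrightarrow> w m = d"
  obtains p q where "p + q = d" "\<And>m. m \<in> Poly_Mapping.keys f \<Longrightarrow> w m = p"
    "\<And>m. m \<in> Poly_Mapping.keys g \<Longrightarrow> w m = q"
proof -
  have nz': "f \<noteq> 0" "g \<noteq> 0" using nz by auto
  let ?u = "\<lambda>m. int (w m)" and ?l = "\<lambda>m. - int (w m)"
  have up: "Max (?u ` Poly_Mapping.keys f) + Max (?u ` Poly_Mapping.keys g) = int d"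
    using max_weight_mult[of ?u f g] add nz' hom by auto
  have low: "Max (?l ` Poly_Mapping.keys f) + Max (?l ` Poly_Mapping.keys g) = - int d"
    using max_weight_mult[of ?l f g] add nz' hom by auto
  have bd: "?u m \<le> Max (?u ` Poly_Mapping.keys h)" "?l m \<le> Max (?l ` Poly_Mapping.keys h)"
    if "m \<in> Poly_Mapping.keys h" for m and h :: "'m \<Rightarrow>\<^sub>0 'a"
    using that by auto
  obtain a b where ab: "a \<in> Poly_Mapping.keys f" "b \<in> Poly_Mapping.keys g"
    using nz' by (metis all_not_in_conv keys_eq_empty)
  have f: "w m = w a" if "m \<in> Poly_Mapping.keys f" for m
    using bd[OF that] bd[OF ab(1)] bd[OF ab(2)] up low by linarith
  have g: "w m = w b" if "m \<in> Poly_Mapping.keys g" for m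
    using bd[OF that] bd[OF ab(1)] bd[OF ab(2)] up low by linarith
  have "w a + w b = d"
    using bd[OF ab(1)] bd[OF ab(2)] up low by linarith
  with f g show thesis by (intro that[of "w a" "w b"])
qed

text \<open>The degree on each factor is an additive weight. So is the exponent of a single
  variable; for a variable outside the allowed range it is 0 on the product, hence 0 on both
  factors.\<close>

lemma multihomogeneous_factors:
  fixes f g :: "'a :: field mpoly"
  assumes hom: "multihomogeneous k n d (f * g)" and nz: "f * g \<noteq> 0"
  obtains p q where "\<And>i. i \<in> {1..k} \<Longrightarrow> p i + q i = d i"
    "multihomogeneous k n p f" "multihomogeneous k n q g"
proof -
  let ?w = "\<lambda>i m. \<Sum>j\<in>{0..n i}. Poly_Mapping.lookup m (i, j :: nat) :: nat"
  let ?V = "SIGMA i:{1..k}. {0..n i}"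
  have "\<exists>p q. p + q = d i \<and> (\<forall>m\<in>Poly_Mapping.keys f. ?w i m = p) \<and> (\<forall>m\<in>Poly_Mapping.keys g. ?w i m = q)"
    if "i \<in> {1..k}" for i
  proof -
    have add: "?w i (m + m') = ?w i m + ?w i m'" for m m' by (simp add: lookup_add sum.distrib)
    have d: "?w i m = d i" if "m \<in> Poly_Mapping.keys (f * g)" for m
      using hom that \<open>i \<in> {1..k}\<close> by (auto simp: multihomogeneous_def)
    show ?thesis by (rule homogeneous_factors[of "?w i" f g "d i", OF add nz d]) blast+
  qed
  then obtain p q where pq: "\<And>i. i \<in> {1..k} \<Longrightarrow> p i + q i = d i"
    "\<And>i m. i \<in> {1..k} \<Longrightarrow> m \<in> Poly_Mapping.keys f \<Longrightarrow> ?w i m = p i"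
    "\<And>i m. i \<in> {1..k} \<Longrightarrow> m \<in> Poly_Mapping.keys g \<Longrightarrow> ?w i m = q i"
    by metis
  have zero: "(\<forall>m\<in>Poly_Mapping.keys f. Poly_Mapping.lookup m x = 0) \<and>
      (\<forall>m\<in>Poly_Mapping.keys g. Poly_Mapping.lookup m x = 0)" if "x \<notin> ?V" for x
  proof -
    have vanish: "Poly_Mapping.lookup m x = 0" if "m \<in> Poly_Mapping.keys (f * g)" for m
      using hom that \<open>x \<notin> ?V\<close> unfolding multihomogeneous_def
      by (meson not_in_keys_iff_lookup_eq_zero subsetD)
    show ?thesis
      by (rule homogeneous_factors[of "\<lambda>m. Poly_Mapping.lookup m x" f g 0, OF lookup_add nz vanish]) auto
  qed
  have V: "Poly_Mapping.keys m \<subseteq> ?V"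
    if "m \<in> Poly_Mapping.keys f \<or> m \<in> Poly_Mapping.keys g" for m
  proof
    fix x assume "x \<in> Poly_Mapping.keys m"
    then show "x \<in> ?V" using zero[of x] that by (meson in_keys_iff)
  qed
  have "multihomogeneous k n p f" "multihomogeneous k n q g"
    unfolding multihomogeneous_def using pq V by blast+
  then show thesis using pq(1) by (intro that)
qed

section \<open>Divisors\<close>

lemma multihomogeneous_mult:
  assumes f: "multihomogeneous k n p f" and g: "multihomogeneous k n q g"
  shows "multihomogeneous k n (\<lambda>i. p i + q i) (f * g)"
  unfolding multihomogeneous_def
proof (intro ballI conjI)
  fix m assume "m \<in> Poly_Mapping.keys (f * g)"
  then obtain a b where ab: "m = a + b" "a \<in> Poly_Mapping.keys f" "b \<in> Poly_Mapping.keys g"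
    using Poly_Mapping.keys_mult[of f g] by blast
  have "Poly_Mapping.keys a \<union> Poly_Mapping.keys b \<subseteq> (SIGMA i:{1..k}. {0..n i})"
    using f g ab(2,3) unfolding multihomogeneous_def by blast
  then show "Poly_Mapping.keys m \<subseteq> (SIGMA i:{1..k}. {0..n i})"
    unfolding ab(1) using Poly_Mapping.keys_add[of a b] by (rule subset_trans[rotated])
  show "(\<Sum>j\<in>{0..n i}. Poly_Mapping.lookup m (i, j)) = p i + q i" if "i \<in> {1..k}" for i
    using f g ab(2,3) that unfolding multihomogeneous_def ab(1)
    by (simp add: lookup_add sum.distrib)
qed

lemma multihomogeneous_cong:
  assumes "\<And>i. i \<in> {1..k} \<Longrightarrow> p i = q i"
  shows "multihomogeneous k n p f \<longleftrightarrow> multihomogeneous k n q f"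
  using assms unfolding multihomogeneous_def by simp

text \<open>No variable can occur in \<open>f\<close>, so \<open>f\<close> is a nonzero
  constant.\<close>

lemma multihomogeneous_0_dvd_1:
  fixes f :: "'a :: field mpoly"
  assumes f: "multihomogeneous k n p f" "f \<noteq> 0" and p: "\<And>i. i \<in> {1..k} \<Longrightarrow> p i = 0"
  shows "f dvd 1"
proof -
  have keys: "Poly_Mapping.keys f \<subseteq> {0}"
  proof
    fix m assume m: "m \<in> Poly_Mapping.keys f"
    have "Poly_Mapping.lookup m (i, j) = 0" for i j
    proof (rule ccontr)
      assume "Poly_Mapping.lookup m (i, j) \<noteq> 0"
      then have "(i, j) \<in> Poly_Mapping.keys m" by (simp add: in_keys_iff)
      then have ij: "i \<in> {1..k}" "j \<in> {0..n i}" using f(1) m unfolding multihomogeneous_def by blast+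
      then have "(\<Sum>j\<in>{0..n i}. Poly_Mapping.lookup m (i, j)) = 0"
        using f(1) m p unfolding multihomogeneous_def by simp
      then show False using ij \<open>Poly_Mapping.lookup m (i, j) \<noteq> 0\<close> by simp
    qed
    then have "m = 0" by (intro poly_mapping_eqI) auto
    then show "m \<in> {0}" by simp
  qed
  define c where "c = Poly_Mapping.lookup f 0"
  have "f = Poly_Mapping.single 0 c"
    using keys by (intro poly_mapping_eqI) (auto simp: c_def lookup_single when_def in_keys_iff)
  moreover from this have "c \<noteq> 0" using f(2) by auto
  ultimately have "f * Poly_Mapping.single 0 (inverse c) = 1" by (simp add: mult_single)
  then show ?thesis by (metis dvd_triv_left)
qed

text \<open>\<open>f\<close> is a factor of 1, which has multidegree 0; as \<open>f\<close> is
  nonzero, any of its monomials determines its multidegree.\<close>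

lemma multihomogeneous_dvd_1_imp_0:
  fixes f :: "'a :: field mpoly"
  assumes f: "multihomogeneous k n p f" "f dvd 1" and i: "i \<in> {1..k}"
  shows "p i = 0"
proof -
  obtain g where g: "f * g = 1" using f(2) by (metis dvdE)
  have hom: "multihomogeneous k n (\<lambda>_. 0) (f * g)" unfolding g by (simp add: multihomogeneous_def)
  have "f * g \<noteq> 0" by (simp add: g)
  then obtain p' q' where "\<And>i. i \<in> {1..k} \<Longrightarrow> p' i + q' i = 0" "multihomogeneous k n p' f"
    by (rule multihomogeneous_factors[OF hom]) blast
  moreover have "f \<noteq> 0" using g by auto
  then obtain m where "m \<in> Poly_Mapping.keys f" by (metis all_not_in_conv keys_eq_empty)
  ultimately show ?thesis using f(1) i unfolding multihomogeneous_def by fastforce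
qed

lemma mpoly_eval_rescale:
  fixes f :: "'a :: field mpoly"
  assumes f: "multihomogeneous k n d f"
    and v: "\<And>i. i \<in> {1..k} \<Longrightarrow> v i = (\<lambda>j. s i * w i j)"
  shows "mpoly_eval f v = (\<Prod>i\<in>{1..k}. s i ^ d i) * mpoly_eval f w"
proof -
  let ?V = "SIGMA i:{1..k}. {0..n i}"
  have "mon_eval v m = (\<Prod>i\<in>{1..k}. s i ^ d i) * mon_eval w m" if m: "m \<in> Poly_Mapping.keys f" for m
  proof -
    have V: "Poly_Mapping.keys m \<subseteq> ?V" and
      deg: "\<And>i. i \<in> {1..k} \<Longrightarrow> (\<Sum>j\<in>{0..n i}. Poly_Mapping.lookup m (i, j)) = d i"
      using f m unfolding multihomogeneous_def by blast+
    have "mon_eval v m = (\<Prod>(i, j)\<in>?V. v i j ^ Poly_Mapping.lookup m (i, j))"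
      using V by (intro mon_eval_superset) auto
    also have "\<dots> = (\<Prod>(i, j)\<in>?V. s i ^ Poly_Mapping.lookup m (i, j)) *
        (\<Prod>(i, j)\<in>?V. w i j ^ Poly_Mapping.lookup m (i, j))"
      unfolding prod.distrib[symmetric]
      by (intro prod.cong[OF refl]) (auto simp: v power_mult_distrib)
    also have "(\<Prod>(i, j)\<in>?V. w i j ^ Poly_Mapping.lookup m (i, j)) = mon_eval w m"
      using V by (intro mon_eval_superset[symmetric]) auto
    also have "(\<Prod>(i, j)\<in>?V. s i ^ Poly_Mapping.lookup m (i, j)) =
        (\<Prod>i\<in>{1..k}. \<Prod>j\<in>{0..n i}. s i ^ Poly_Mapping.lookup m (i, j))"
      by (rule prod.Sigma[symmetric]) auto
    also have "\<dots> = (\<Prod>i\<in>{1..k}. s i ^ d i)"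
      by (intro prod.cong[OF refl]) (simp add: deg flip: power_sum)
    finally show ?thesis .
  qed
  then have "(\<Sum>m\<in>Poly_Mapping.keys f. Poly_Mapping.lookup f m * mon_eval v m) =
      (\<Sum>m\<in>Poly_Mapping.keys f. (\<Prod>i\<in>{1..k}. s i ^ d i) * (Poly_Mapping.lookup f m * mon_eval w m))"
    by (intro sum.cong[OF refl]) (simp add: ac_simps)
  then show ?thesis
    by (simp add: mpoly_eval_superset[OF _ order_refl] sum_distrib_left)
qed

lemma divisor_ofI: "c \<noteq> 0 \<Longrightarrow> Poly_Mapping.single 0 c * f \<in> divisor_of f"
  unfolding divisor_of_def by blast

lemma divisor_ofE:
  assumes "g \<in> divisor_of f"
  obtains c where "c \<noteq> 0" "g = Poly_Mapping.single 0 c * f"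
  using assms unfolding divisor_of_def by blast

lemma in_divisor_of_self: "f \<in> divisor_of f"
  using divisor_ofI[of 1 f] by simp

lemma divisor_of_single_mult:
  fixes f :: "'a :: field mpoly"
  assumes "c \<noteq> 0"
  shows "divisor_of (Poly_Mapping.single 0 c * f) = divisor_of f"
proof -
  have 1: "divisor_of (Poly_Mapping.single 0 c * f) \<subseteq> divisor_of f"
    if "c \<noteq> 0" for c and f :: "'a mpoly"
  proof
    fix g assume "g \<in> divisor_of (Poly_Mapping.single 0 c * f)"
    then obtain b where "b \<noteq> 0" "g = Poly_Mapping.single 0 b * (Poly_Mapping.single 0 c * f)"
      by (rule divisor_ofE)
    then have "g = Poly_Mapping.single 0 (b * c) * f" "b * c \<noteq> 0"
      using that by (simp_all only: mult.assoc[symmetric] mult_single add_0_right mult_eq_0_iff not_False_eq_True simp_thms)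
    then show "g \<in> divisor_of f" using divisor_ofI[of "b * c" f] by simp
  qed
  have "Poly_Mapping.single 0 (inverse c) * Poly_Mapping.single 0 c = (1 :: 'a mpoly)"
    using assms by (simp add: mult_single)
  then have "Poly_Mapping.single 0 (inverse c) * (Poly_Mapping.single 0 c * f) = f"
    by (simp flip: mult.assoc)
  with 1[of "inverse c" "Poly_Mapping.single 0 c * f"] assms
  have "divisor_of f \<subseteq> divisor_of (Poly_Mapping.single 0 c * f)" by simp
  with 1[OF assms, of f] show ?thesis by blast
qed

lemma divisor_union_divisor_of:
  fixes f g :: "'a :: field mpoly"
  shows "divisor_union (divisor_of f) (divisor_of g) = divisor_of (f * g)"
proof (intro equalityI subsetI)
  fix h assume "h \<in> divisor_union (divisor_of f) (divisor_of g)"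
  then obtain b c where "b \<noteq> 0" "c \<noteq> 0"
    "h = Poly_Mapping.single 0 b * f * (Poly_Mapping.single 0 c * g)"
    unfolding divisor_union_def divisor_of_def by blast
  then have "h = (Poly_Mapping.single 0 b * Poly_Mapping.single 0 c) * (f * g)"
    by (simp only: mult_ac)
  then have "h = Poly_Mapping.single 0 (b * c) * (f * g)"
    by (simp only: mult_single add_0_right)
  then show "h \<in> divisor_of (f * g)" using divisor_ofI[of "b * c"] \<open>b \<noteq> 0\<close> \<open>c \<noteq> 0\<close> by simp
next
  fix h assume "h \<in> divisor_of (f * g)"
  then obtain c where c: "c \<noteq> 0" "h = Poly_Mapping.single 0 c * (f * g)"
    by (rule divisor_ofE)
  then have "h = (Poly_Mapping.single 0 c * f) * g" by (simp only: mult.assoc)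
  then show "h \<in> divisor_union (divisor_of f) (divisor_of g)"
    unfolding divisor_union_def using in_divisor_of_self[of g] divisor_ofI[OF c(1), of f] by blast
qed

text \<open>Changing representatives rescales the value of a form, so vanishing can be tested at
  \<open>rep y\<close> alone.\<close>

lemma in_divisor_points_iff:
  fixes f :: "'a :: field mpoly"
  assumes f: "multihomogeneous k n d f" and y: "y \<in> multiproj k n"
  shows "y \<in> divisor_points k n (divisor_of f) \<longleftrightarrow> mpoly_eval f (rep y) = 0"
proof
  assume "y \<in> divisor_points k n (divisor_of f)"
  moreover have "rep y i \<in> y i - {0}" if "i \<in> {1..k}" for i
    using rep_nonzero[OF y that] hpoint_rep[OF y that]
    by (metis DiffI hpoint_def singletonD singletonI vec.span_base)
  ultimately show "mpoly_eval f (rep y) = 0"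
    using in_divisor_of_self unfolding divisor_points_def by blast
next
  assume 0: "mpoly_eval f (rep y) = 0"
  have "mpoly_eval g v = 0" if g: "g \<in> divisor_of f" and v: "\<forall>i\<in>{1..k}. v i \<in> y i - {0}" for g v
  proof -
    have "\<exists>s. v i = (\<lambda>j. s * rep y i j)" if i: "i \<in> {1..k}" for i
    proof -
      have "v i \<in> vec.span {rep y i}"
        using v i hpoint_rep[OF y i] unfolding hpoint_def by blast
      then show ?thesis by (auto simp: vec.span_singleton)
    qed
    then obtain s where "\<And>i. i \<in> {1..k} \<Longrightarrow> v i = (\<lambda>j. s i * rep y i j)" by metis
    then have "mpoly_eval f v = 0" using mpoly_eval_rescale[OF f] 0 by simp
    then show ?thesis using g by (auto simp: divisor_of_def mpoly_eval_mult)
  qed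
  then show "y \<in> divisor_points k n (divisor_of f)" using y by (simp add: divisor_points_def)
qed

section \<open>Forms of multidegree (1,...,1) as linear forms on the Segre target\<close>

definition multilinear_mon :: "nat \<Rightarrow> (nat \<Rightarrow> nat) \<Rightarrow> nat \<times> nat \<Rightarrow>\<^sub>0 nat" where
  "multilinear_mon k J = (\<Sum>i\<in>{1..k}. Poly_Mapping.single (i, J i) 1)"

lemma lookup_multilinear_mon:
  "Poly_Mapping.lookup (multilinear_mon k J) (i, j) = (if i \<in> {1..k} \<and> J i = j then 1 else 0)"
proof -
  have "Poly_Mapping.lookup (multilinear_mon k J) (i, j) =
      (\<Sum>l\<in>{1..k}. if l = i then (if J i = j then 1 else 0) else 0)"
    unfolding multilinear_mon_def lookup_sum
    by (intro sum.cong[OF refl]) (auto simp: lookup_single when_def)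
  then show ?thesis by auto
qed

lemma inj_on_multilinear_mon: "inj_on (multilinear_mon k) (multi_indices k n)"
proof (rule inj_onI)
  fix J J' assume J: "J \<in> multi_indices k n" "J' \<in> multi_indices k n"
    and eq: "multilinear_mon k J = multilinear_mon k J'"
  have "J i = J' i" if "i \<in> {1..k}" for i
  proof (rule ccontr)
    assume "J i \<noteq> J' i"
    then have "Poly_Mapping.lookup (multilinear_mon k J') (i, J i) = 0"
      unfolding lookup_multilinear_mon by (simp only: if_False simp_thms eq_commute)
    moreover have "Poly_Mapping.lookup (multilinear_mon k J) (i, J i) = 1"
      unfolding lookup_multilinear_mon using that by (simp only: simp_thms if_True)
    ultimately show False unfolding eq by simp
  qed
  then show "J = J'" by (rule PiE_ext[OF J[unfolded multi_indices_def]])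
qed

lemma multilinear_keys:
  assumes f: "multihomogeneous k n d f" and d: "\<And>i. i \<in> {1..k} \<Longrightarrow> d i = 1"
  shows "Poly_Mapping.keys f \<subseteq> multilinear_mon k ` multi_indices k n"
proof
  fix m assume m: "m \<in> Poly_Mapping.keys f"
  have V: "Poly_Mapping.keys m \<subseteq> (SIGMA i:{1..k}. {0..n i})" and
    deg: "\<And>i. i \<in> {1..k} \<Longrightarrow> (\<Sum>j\<in>{0..n i}. Poly_Mapping.lookup m (i, j)) = 1"
    using f m d unfolding multihomogeneous_def by fastforce+
  \<comment> \<open>Natural numbers with sum 1 are one 1 and otherwise 0, so each factor contributes
    exactly one variable.\<close>
  have "\<exists>j\<in>{0..n i}. Poly_Mapping.lookup m (i, j) = 1 \<and>
      (\<forall>j'\<in>{0..n i}. j \<noteq> j' \<longrightarrow> Poly_Mapping.lookup m (i, j') = 0)" if "i \<in> {1..k}" for i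
    using deg[OF that] by (simp only: sum_eq_1_iff[OF finite_atLeastAtMost])
  then obtain J where J: "\<And>i. i \<in> {1..k} \<Longrightarrow> J i \<in> {0..n i}"
    "\<And>i. i \<in> {1..k} \<Longrightarrow> Poly_Mapping.lookup m (i, J i) = 1"
    "\<And>i j. i \<in> {1..k} \<Longrightarrow> j \<in> {0..n i} \<Longrightarrow> J i \<noteq> j \<Longrightarrow> Poly_Mapping.lookup m (i, j) = 0"
    by metis
  have "m = multilinear_mon k (restrict J {1..k})"
  proof (rule poly_mapping_eqI)
    fix x :: "nat \<times> nat"
    obtain i j where x: "x = (i, j)" by fastforce
    show "Poly_Mapping.lookup m x = Poly_Mapping.lookup (multilinear_mon k (restrict J {1..k})) x"
    proof (cases "x \<in> (SIGMA i:{1..k}. {0..n i})")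
      case True
      then show ?thesis using J by (auto simp: x lookup_multilinear_mon)
    next
      case False
      then have "Poly_Mapping.lookup m x = 0" using V by (meson in_keys_iff subsetD)
      moreover have "\<not> (i \<in> {1..k} \<and> restrict J {1..k} i = j)" using False J(1) by (auto simp: x)
      ultimately show ?thesis unfolding x lookup_multilinear_mon by simp
    qed
  qed
  moreover have "restrict J {1..k} \<in> multi_indices k n" using J(1) by (auto simp: multi_indices_def)
  ultimately show "m \<in> multilinear_mon k ` multi_indices k n" by blast
qed

text \<open>Multilinear monomials correspond to the coordinates of the Segre target, so containment
  of points in such a divisor becomes a linear condition on its coefficients.\<close>

lemma mpoly_eval_multilinear:
  fixes f :: "'a :: field mpoly"
  assumes f: "multihomogeneous k n d f" and d: "\<And>i. i \<in> {1..k} \<Longrightarrow> d i = 1"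
  shows "mpoly_eval f v =
    pairing (multi_indices k n) (\<lambda>J. Poly_Mapping.lookup f (multilinear_mon k J)) (segre_coords k n v)"
proof -
  have "mpoly_eval f v =
    (\<Sum>m\<in>multilinear_mon k ` multi_indices k n. Poly_Mapping.lookup f m * mon_eval v m)"
    using multilinear_keys[OF f d] by (intro mpoly_eval_superset finite_imageI finite_multi_indices)
  also have "\<dots> = (\<Sum>J\<in>multi_indices k n.
      Poly_Mapping.lookup f (multilinear_mon k J) * mon_eval v (multilinear_mon k J))"
    by (subst sum.reindex[OF inj_on_multilinear_mon]) simp
  finally show ?thesis
    by (simp add: pairing_def segre_coords_def multilinear_mon_def mon_eval_sum mon_eval_single)
qed

lemma multilinear_form_exists:
  fixes F :: "(nat \<Rightarrow> nat) \<Rightarrow> 'a :: field"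
  assumes d: "\<And>i. i \<in> {1..k} \<Longrightarrow> d i = 1"
  obtains f where "multihomogeneous k n d f"
    "\<And>J. J \<in> multi_indices k n \<Longrightarrow> Poly_Mapping.lookup f (multilinear_mon k J) = F J"
proof -
  define f where "f = (\<Sum>J\<in>multi_indices k n. Poly_Mapping.single (multilinear_mon k J) (F J))"
  have look: "Poly_Mapping.lookup f (multilinear_mon k J) = F J" if J: "J \<in> multi_indices k n" for J
  proof -
    have "Poly_Mapping.lookup f (multilinear_mon k J) =
        (\<Sum>I\<in>multi_indices k n. if I = J then F J else 0)"
      unfolding f_def lookup_sum
      by (intro sum.cong[OF refl])
        (auto simp: lookup_single when_def J inj_on_eq_iff[OF inj_on_multilinear_mon])
    then show ?thesis using J by (simp add: finite_multi_indices)
  qed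
  have "multihomogeneous k n d f"
    unfolding multihomogeneous_def
  proof (intro ballI conjI)
    fix m assume "m \<in> Poly_Mapping.keys f"
    then obtain J where J: "J \<in> multi_indices k n" "m = multilinear_mon k J"
      using keys_sum[of "\<lambda>J. Poly_Mapping.single (multilinear_mon k J) (F J)" "multi_indices k n"]
      by (fastforce simp: f_def split: if_splits)
    then have JP: "\<And>i. i \<in> {1..k} \<Longrightarrow> J i \<in> {0..n i}" by (auto simp: multi_indices_def)
    show "Poly_Mapping.keys m \<subseteq> (SIGMA i:{1..k}. {0..n i})"
    proof
      fix x assume "x \<in> Poly_Mapping.keys m"
      then obtain i j where "x = (i, j)" "i \<in> {1..k}" "J i = j"
        by (cases x) (auto simp: in_keys_iff J(2) lookup_multilinear_mon split: if_splits)
      then show "x \<in> (SIGMA i:{1..k}. {0..n i})" using JP[of i] by auto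
    qed
    show "(\<Sum>j\<in>{0..n i}. Poly_Mapping.lookup m (i, j)) = d i" if "i \<in> {1..k}" for i
      using JP[OF that] that d[OF that] by (simp add: J(2) lookup_multilinear_mon)
  qed
  with look show thesis by (intro that)
qed

section \<open>Linear forms on one factor and points of the projective line\<close>

lemma linear_form_eval:
  fixes f :: "'a :: field mpoly"
  assumes f: "multihomogeneous k n d f" and i: "i \<in> {1..k}"
    and d: "d i = 1" "\<And>l. l \<in> {1..k} \<Longrightarrow> l \<noteq> i \<Longrightarrow> d l = 0"
  shows linear_form_keys: "Poly_Mapping.keys f \<subseteq> (\<lambda>j. Poly_Mapping.single (i, j) 1) ` {0..n i}"
    and mpoly_eval_linear: "mpoly_eval f v =
      pairing {0..n i} (\<lambda>j. Poly_Mapping.lookup f (Poly_Mapping.single (i, j) 1)) (v i)"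
proof -
  show keys: "Poly_Mapping.keys f \<subseteq> (\<lambda>j. Poly_Mapping.single (i, j) 1) ` {0..n i}"
  proof
    fix m assume m: "m \<in> Poly_Mapping.keys f"
    have V: "Poly_Mapping.keys m \<subseteq> (SIGMA i:{1..k}. {0..n i})" and
      deg: "\<And>l. l \<in> {1..k} \<Longrightarrow> (\<Sum>j\<in>{0..n l}. Poly_Mapping.lookup m (l, j)) = d l"
      using f m unfolding multihomogeneous_def by blast+
    have "\<exists>j\<in>{0..n i}. Poly_Mapping.lookup m (i, j) = 1 \<and>
        (\<forall>j'\<in>{0..n i}. j \<noteq> j' \<longrightarrow> Poly_Mapping.lookup m (i, j') = 0)"
      using deg[OF i] d(1) by (simp only: sum_eq_1_iff[OF finite_atLeastAtMost])
    then obtain j where j: "j \<in> {0..n i}" "Poly_Mapping.lookup m (i, j) = 1"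
      "\<And>j'. j' \<in> {0..n i} \<Longrightarrow> j \<noteq> j' \<Longrightarrow> Poly_Mapping.lookup m (i, j') = 0" by blast
    have "m = Poly_Mapping.single (i, j) 1"
    proof (rule poly_mapping_eqI)
      fix x :: "nat \<times> nat"
      obtain a b where x: "x = (a, b)" by fastforce
      consider "x = (i, j)" | "x \<notin> (SIGMA i:{1..k}. {0..n i})"
        | "a = i" "b \<in> {0..n i}" "b \<noteq> j" | "a \<in> {1..k}" "b \<in> {0..n a}" "a \<noteq> i"
        unfolding x by blast
      then show "Poly_Mapping.lookup m x = Poly_Mapping.lookup (Poly_Mapping.single (i, j) 1) x"
      proof cases
        case 1
        then show ?thesis using j(2) by simp
      next
        case 2
        then have "Poly_Mapping.lookup m x = 0" using V by (meson in_keys_iff subsetD)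
        moreover have "x \<noteq> (i, j)" using 2 i j(1) by auto
        ultimately show ?thesis by (simp add: lookup_single when_def)
      next
        case 3
        then show ?thesis using j(3)[of b] by (simp add: x lookup_single when_def)
      next
        case 4
        then have "Poly_Mapping.lookup m (a, b) = 0" using deg[of a] d(2)[of a] by simp
        then show ?thesis using 4 by (simp add: x lookup_single when_def)
      qed
    qed
    then show "m \<in> (\<lambda>j. Poly_Mapping.single (i, j) 1) ` {0..n i}" using j(1) by blast
  qed
  have inj: "inj_on (\<lambda>j. Poly_Mapping.single (i, j) (1::nat)) {0..n i}"
  proof (rule inj_onI)
    fix a b assume "Poly_Mapping.single (i, a) (1::nat) = Poly_Mapping.single (i, b) 1"
    then have "Poly_Mapping.keys (Poly_Mapping.single (i, a) (1::nat)) =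
      Poly_Mapping.keys (Poly_Mapping.single (i, b) (1::nat))" by (rule arg_cong)
    then show "a = b" by simp
  qed
  have "mpoly_eval f v = (\<Sum>m\<in>(\<lambda>j. Poly_Mapping.single (i, j) 1) ` {0..n i}.
      Poly_Mapping.lookup f m * mon_eval v m)"
    by (rule mpoly_eval_superset[OF _ keys]) simp
  then show "mpoly_eval f v =
      pairing {0..n i} (\<lambda>j. Poly_Mapping.lookup f (Poly_Mapping.single (i, j) 1)) (v i)"
    unfolding sum.reindex[OF inj] by (simp add: pairing_def mon_eval_single)
qed

lemma proportional_in_plane:
  fixes v w :: "nat \<Rightarrow> 'a :: field"
  assumes vw: "v \<in> coord_space {0..1}" "w \<in> coord_space {0..1}" "v \<noteq> 0" "w \<noteq> 0"
    and det: "v 0 * w 1 = v 1 * w 0"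
  shows "hpoint v = hpoint w"
proof -
  have out: "v x = 0" "w x = 0" if "x \<noteq> 0" "x \<noteq> 1" for x
    using vw that by (auto simp: coord_space_def)
  obtain l where l: "l = 0 \<or> l = 1" "w l \<noteq> 0"
    using vw(4) out(2) by (metis ext zero_fun_apply)
  have "v x = v l / w l * w x" for x
    using l det out[of x] by (cases "x = 0"; cases "x = 1") (auto simp: field_simps)
  then have "v = (\<lambda>x. v l / w l * w x)" by (rule ext)
  then have "v \<in> vec.span {w}" unfolding vec.span_singleton by (rule image_eqI) simp
  then show ?thesis using hpoint_eq_iff[OF vw(3)] by blast
qed

lemma linear_form_one_point:
  fixes f :: "'a :: field mpoly"
  assumes f: "multihomogeneous k n d f" "f \<noteq> 0" and i: "i \<in> {1..k}" "n i = 1"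
    and d: "d i = 1" "\<And>l. l \<in> {1..k} \<Longrightarrow> l \<noteq> i \<Longrightarrow> d l = 0"
    and x: "x \<in> multiproj k n" "mpoly_eval f (rep x) = 0"
    and y: "y \<in> multiproj k n" "mpoly_eval f (rep y) = 0"
  shows "x i = y i"
proof -
  define \<alpha> where "\<alpha> j = Poly_Mapping.lookup f (Poly_Mapping.single (i, j) 1)" for j
  have eval: "mpoly_eval f v = \<alpha> 0 * v i 0 + \<alpha> 1 * v i 1" for v
  proof -
    have "{0..n i} = {0, 1}" using i(2) by auto
    then show ?thesis
      using mpoly_eval_linear[OF f(1) i(1) d, of v] by (simp add: pairing_def \<alpha>_def)
  qed
  have "\<alpha> 0 \<noteq> 0 \<or> \<alpha> 1 \<noteq> 0"
  proof -
    obtain m where m: "m \<in> Poly_Mapping.keys f" using f(2) by (metis all_not_in_conv keys_eq_empty)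
    then obtain j where "j \<in> {0..n i}" "m = Poly_Mapping.single (i, j) 1"
      using linear_form_keys[OF f(1) i(1) d] by blast
    moreover from this have "\<alpha> j \<noteq> 0" using m by (simp add: \<alpha>_def in_keys_iff)
    ultimately show ?thesis using i(2) by (cases "j = 0") (auto simp: le_Suc_eq)
  qed
  moreover have "\<alpha> 0 * rep x i 0 + \<alpha> 1 * rep x i 1 = 0" "\<alpha> 0 * rep y i 0 + \<alpha> 1 * rep y i 1 = 0"
    using x(2) y(2) eval by simp_all
  \<comment> \<open>Eliminating between the two equations shows that each coefficient annihilates
    the determinant of the two points; one coefficient is nonzero.\<close>
  then have "\<alpha> 0 * (rep x i 0 * rep y i 1 - rep x i 1 * rep y i 0) = 0"
    "\<alpha> 1 * (rep x i 0 * rep y i 1 - rep x i 1 * rep y i 0) = 0"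
    by algebra+
  ultimately have "rep x i 0 * rep y i 1 = rep x i 1 * rep y i 0" by auto
  then have "hpoint (rep x i) = hpoint (rep y i)"
    using rep_coord_space[OF x(1) i(1)] rep_coord_space[OF y(1) i(1)] i
      rep_nonzero[OF x(1) i(1)] rep_nonzero[OF y(1) i(1)]
    by (intro proportional_in_plane) simp_all
  then show ?thesis using hpoint_rep[OF x(1) i(1)] hpoint_rep[OF y(1) i(1)] by simp
qed

lemma linear_form_through_point:
  fixes x :: "nat \<Rightarrow> (nat \<Rightarrow> 'a :: field) set"
  assumes x: "x \<in> multiproj k n" and i: "i \<in> {1..k}" "n i = 1"
    and d: "d i = 1" "\<And>l. l \<in> {1..k} \<Longrightarrow> l \<noteq> i \<Longrightarrow> d l = 0"
  obtains f :: "'a mpoly" where "multihomogeneous k n d f" "f \<noteq> 0"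
    "\<And>y. y \<in> multiproj k n \<Longrightarrow> y i = x i \<Longrightarrow> mpoly_eval f (rep y) = 0"
proof -
  let ?e = "\<lambda>j. Poly_Mapping.single (i, j :: nat) (1 :: nat)"
  \<comment> \<open>The equation of the point with coordinates x0, x1 on the line: x1 X0 - x0
    X1.\<close>
  define f where "f = Poly_Mapping.single (?e 0) (rep x i 1) - Poly_Mapping.single (?e 1) (rep x i 0)"
  have e01: "?e 0 \<noteq> ?e 1"
  proof
    assume "?e 0 = ?e 1"
    then have "Poly_Mapping.lookup (?e 0) (i, 0) = Poly_Mapping.lookup (?e 1) (i, 0)" by simp
    then show False by (simp add: lookup_single when_def)
  qed
  have "multihomogeneous k n d f"
    unfolding multihomogeneous_def
  proof (intro ballI conjI)
    fix m assume "m \<in> Poly_Mapping.keys f"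
    then have "m = ?e 0 \<or> m = ?e 1"
      by (auto simp: f_def in_keys_iff lookup_minus lookup_single when_def split: if_splits)
    then obtain j where j: "m = ?e j" "j \<in> {0..n i}" using i(2) by auto
    show "Poly_Mapping.keys m \<subseteq> (SIGMA i:{1..k}. {0..n i})" using j i by auto
    show "(\<Sum>j\<in>{0..n l}. Poly_Mapping.lookup m (l, j)) = d l" if l: "l \<in> {1..k}" for l
    proof (cases "l = i")
      case True
      have "(\<Sum>j'\<in>{0..n i}. Poly_Mapping.lookup m (i, j')) = (\<Sum>j'\<in>{0..n i}. if j' = j then 1 else 0)"
        by (intro sum.cong[OF refl]) (auto simp: j(1) lookup_single when_def)
      then show ?thesis using True j(2) d(1) by simp
    next
      case False
      then show ?thesis using l d(2)[OF l] by (simp add: j(1) lookup_single when_def)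
    qed
  qed
  moreover have "f \<noteq> 0"
  proof
    assume "f = 0"
    then have "Poly_Mapping.lookup f (?e 0) = 0" "Poly_Mapping.lookup f (?e 1) = 0" by simp_all
    then have "rep x i 1 = 0" "rep x i 0 = 0"
      using e01 by (simp_all add: f_def lookup_minus lookup_single when_def)
    moreover have "rep x i j = 0" if "j \<noteq> 0" "j \<noteq> 1" for j
      using rep_coord_space[OF x i(1)] that i(2) by (auto simp: coord_space_def)
    ultimately have "rep x i = 0" by (metis ext zero_fun_apply)
    then show False using rep_nonzero[OF x i(1)] by simp
  qed
  moreover have "mpoly_eval f (rep y) = 0" if y: "y \<in> multiproj k n" "y i = x i" for y
  proof -
    have "rep y i \<in> vec.span {rep x i}"
      using rep_in_span_singleton_iff[OF y(1) x i(1)] y(2) by simp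
    then obtain s where s: "rep y i = (\<lambda>j. s * rep x i j)" by (auto simp: vec.span_singleton)
    have "f = Poly_Mapping.single (?e 0) (rep x i 1) + Poly_Mapping.single (?e 1) (- rep x i 0)"
      by (simp add: f_def single_uminus)
    then show ?thesis
      by (simp add: mpoly_eval_add mpoly_eval_single mon_eval_single s)
  qed
  ultimately show thesis by (rule that)
qed

section \<open>Nondegenerate circuits of four points\<close>

lemma lookup_single_0_mult:
  fixes f :: "'a :: field mpoly"
  shows "Poly_Mapping.lookup (Poly_Mapping.single 0 c * f) m = c * Poly_Mapping.lookup f m"
proof -
  have "Poly_Mapping.single 0 c * f =
      Poly_Mapping.single 0 c * (\<Sum>m\<in>Poly_Mapping.keys f. Poly_Mapping.single m (Poly_Mapping.lookup f m))"
    by (simp flip: poly_mapping_sum_singles)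
  also have "\<dots> = (\<Sum>m\<in>Poly_Mapping.keys f. Poly_Mapping.single m (c * Poly_Mapping.lookup f m))"
    by (simp add: sum_distrib_left mult_single)
  finally show ?thesis
    by (auto simp: lookup_sum lookup_single when_def in_keys_iff)
qed

lemma multihomogeneous_single_0_mult:
  assumes "multihomogeneous k n d f"
  shows "multihomogeneous k n d (Poly_Mapping.single 0 c * f)"
proof -
  have "multihomogeneous k n (\<lambda>_. 0) (Poly_Mapping.single 0 c)"
    by (simp add: multihomogeneous_def)
  from multihomogeneous_mult[OF this assms] show ?thesis by simp
qed

lemma bidegree_factor:
  "bidegree a b 1 = a" "bidegree a b 2 = b" "i \<in> {1..2} \<Longrightarrow> bidegree 1 1 i = 1"
proof -
  show "bidegree a b 1 = a" "bidegree a b 2 = b" by (simp_all add: bidegree_def)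
  assume "i \<in> {1..2}"
  then have "i = 1 \<or> i = 2" by auto
  then show "bidegree 1 1 i = 1" by (auto simp: bidegree_def)
qed

locale nondegenerate_circuit = nondegenerate_relation k n S c + segre_circuit k n S c
  for k n and S :: "(nat \<Rightarrow> (nat \<Rightarrow> 'a :: field) set) set" and c
begin

lemma equal_factor_card_le_2:
  assumes i: "i \<in> {1..k}" and T: "T \<subseteq> S" "\<And>x y. x \<in> T \<Longrightarrow> y \<in> T \<Longrightarrow> x i = y i"
  shows "card T \<le> 2"
proof (rule ccontr)
  assume "\<not> card T \<le> 2"
  then obtain C where C: "C \<subseteq> T" "card C = 3" using obtain_subset_with_card_n[of 3 T] by auto
  obtain b d e where bde: "C = {b, d, e}" using C(2) unfolding card_3_iff by blast
  have "C \<subseteq> S" using C(1) T(1) by (rule subset_trans)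
  then have "card (S - C) = 1"
    using card_Diff_subset[OF finite_subset[OF _ finite_S], of C] C(2) card_S by simp
  then obtain a where a: "S - C = {a}" by (rule card_1_singletonE)
  with \<open>C \<subseteq> S\<close> have "S = insert a C" "a \<notin> C" by blast+
  then have S: "S = {a, b, d, e}" "a \<noteq> b" "a \<noteq> d" "a \<noteq> e" unfolding bde(1) by simp_all
  have in_T: "b \<in> T" "d \<in> T" "e \<in> T" using C(1) unfolding bde(1) by simp_all
  show False
    using no_three_equal[OF S i T(2)[OF in_T(1,2)]] T(2)[OF in_T(1,3)] by simp
qed

text \<open>With one factor the tensor of a point is its coordinate vector, indexed differently.
  Three vectors of the circuit are independent and the fourth lies in their span, so by
  nondegeneracy they form a basis of a space of dimension \<open>n 1 + 1\<close>.\<close>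

lemma one_factor_dim:
  assumes k: "k = 1"
  shows "n 1 = 2"
proof -
  let ?r = "\<lambda>y. rep y 1"
  have one: "1 \<in> {1..k}" using k by simp
  obtain z where z: "z \<in> S" using S_nonempty by blast
  define T where "T = S - {z}"
  have T: "T \<subset> S" "finite T" "card T = 3" using z card_S finite_S by (auto simp: T_def)
  have coords: "segre_rep k n y J = (if J \<in> multi_indices k n then rep y 1 (J 1) else 0)" for y J
    by (simp add: segre_rep_def segre_coords_def k)
  have ind: "lin_indep_on T ?r"
    unfolding lin_indep_on_def
  proof (intro allI impI)
    fix e assume e: "\<forall>x. (\<Sum>y\<in>T. e y * rep y 1 x) = 0"
    have "(\<Sum>y\<in>T. e y * segre_rep k n y J) = 0" for J
      using spec[OF e, of "J 1"] unfolding coords by (cases "J \<in> multi_indices k n") simp_all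
    then show "\<forall>y\<in>T. e y = 0" using lin_indep_onD[OF proper_independent[OF T(1)]] by blast
  qed
  have rel: "(\<Sum>y\<in>S. c y * rep y 1 x) = 0" for x
  proof (cases "x \<in> {0..n 1}")
    case True
    define J where "J = restrict (\<lambda>_. x) {1..k}"
    have "J \<in> multi_indices k n" "J 1 = x" using True k by (auto simp: J_def multi_indices_def)
    then show ?thesis using relation[of J] unfolding coords by simp
  next
    case False
    have "rep y 1 x = 0" if "y \<in> S" for y
      using rep_coord_space[of y k n 1] that S_sub one False unfolding coord_space_def by blast
    then show ?thesis by simp
  qed
  have zT: "rep z 1 \<in> vec.span (?r ` T)"
  proof -
    have "rep z 1 x = (\<Sum>y\<in>T. - (c y / c z) * rep y 1 x)" for x
    proof -
      have "c z * rep z 1 x + (\<Sum>y\<in>T. c y * rep y 1 x) = 0"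
        using rel[of x] sum.remove[OF finite_S z, of "\<lambda>y. c y * rep y 1 x"] by (simp only: T_def)
      then have "c z * rep z 1 x = - (\<Sum>y\<in>T. c y * rep y 1 x)"
        by (simp only: eq_neg_iff_add_eq_0)
      also have "\<dots> = (\<Sum>y\<in>T. - (c y * rep y 1 x))" by (rule sum_negf[symmetric])
      also have "\<dots> = (\<Sum>y\<in>T. c z * (- (c y / c z) * rep y 1 x))"
        by (rule sum.cong[OF refl]) (simp add: c_nonzero[OF z])
      finally have "c z * rep z 1 x = c z * (\<Sum>y\<in>T. - (c y / c z) * rep y 1 x)"
        by (simp only: sum_distrib_left)
      then show ?thesis using c_nonzero[OF z] by (simp only: mult_cancel_left simp_thms)
    qed
    then have "rep z 1 = (\<lambda>x. \<Sum>y\<in>T. - (c y / c z) * rep y 1 x)" by (rule ext)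
    then show ?thesis
      unfolding span_family_iff[OF T(2)] by (rule exI[of _ "\<lambda>y. - (c y / c z)"])
  qed
  have inj: "inj_on ?r T" using lin_indep_on_imp_inj[OF T(2) ind] .
  have "?r ` S \<subseteq> vec.span (?r ` T)"
  proof
    fix v assume "v \<in> ?r ` S"
    then obtain y where "y \<in> S" "v = rep y 1" by blast
    then show "v \<in> vec.span (?r ` T)"
      using zT by (cases "y = z") (auto simp: T_def intro: vec.span_base)
  qed
  then have "coord_space {0..n 1} \<subseteq> vec.span (?r ` T)"
    unfolding nondegenerate_span[OF nondeg S_sub one, symmetric]
    by (intro vec.span_minimal vec.subspace_span)
  moreover have "?r ` T \<subseteq> coord_space {0..n 1}"
    using T(1) S_sub one rep_coord_space by blast
  ultimately have "card (?r ` T) = n 1 + 1"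
    using vec.basis_card_eq_dim[of "?r ` T"] independent_image_iff[OF T(2) inj] ind
    by (simp add: dim_coord_space)
  then show ?thesis using T(3) card_image[OF inj] by simp
qed

lemma number_of_factors:
  "k = 1 \<and> n 1 = 2 \<or> k = 2 \<and> n 1 = 1 \<and> n 2 = 1"
proof -
  have "k \<noteq> 0"
  proof
    assume "k = 0"
    \<comment> \<open>The empty product consists of a single point.\<close>
    then have "S \<subseteq> {\<lambda>_. undefined}" using S_sub by (simp add: multiproj_def)
    then have "card S \<le> 1" using card_mono[of "{\<lambda>_. undefined}" S] by simp
    then show False using card_S by simp
  qed
  then consider "k = 1" | "k = 2" using at_most_two_factors by linarith
  then show ?thesis
  proof cases
    case 1
    then show ?thesis using one_factor_dim by blast
  next
    case 2
    then show ?thesis using dim_factor[of 1 2] dim_factor[of 2 1] by simp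
  qed
qed

text \<open>The Segre target has 2 * 2 = 4 coordinates, so three independent points determine a
  hyperplane. Evaluating its equation on the circuit relation leaves only the term of the fourth
  point, which therefore lies on it too.\<close>

lemma bilinear_equation:
  assumes k: "k = 2"
  obtains f where "multihomogeneous k n (bidegree 1 1) f" "f \<noteq> 0"
    "\<And>y. y \<in> S \<Longrightarrow> mpoly_eval f (rep y) = 0"
    "\<And>g. multihomogeneous k n (bidegree 1 1) g \<Longrightarrow> (\<And>y. y \<in> S \<Longrightarrow> mpoly_eval g (rep y) = 0) \<Longrightarrow>
      \<exists>r. g = Poly_Mapping.single 0 r * f"
proof -
  let ?M = "multi_indices k n" and ?t = "segre_rep k n"
  have d: "\<And>i. i \<in> {1..k} \<Longrightarrow> bidegree 1 1 i = 1" using k bidegree_factor(3) by blast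
  have n1: "n 1 = 1" "n 2 = 1" using number_of_factors k by auto
  have "{1..k} = {1, 2}" using k by auto
  then have cardM: "card ?M = 4" unfolding card_multi_indices using n1 by simp
  obtain z where z: "z \<in> S" using S_nonempty by blast
  define T where "T = S - {z}"
  have T: "T \<subset> S" "finite T" "card T = 3" using z card_S finite_S by (auto simp: T_def)
  have cardM': "card ?M = Suc (card T)" using cardM T(3) by simp
  obtain F where F: "\<And>y. y \<in> T \<Longrightarrow> pairing ?M F (?t y) = 0" "\<exists>J\<in>?M. F J \<noteq> 0"
    "\<And>G. (\<And>y. y \<in> T \<Longrightarrow> pairing ?M G (?t y) = 0) \<Longrightarrow> \<exists>r. \<forall>J\<in>?M. G J = r * F J"
  proof (rule hyperplane_equation[OF finite_multi_indices T(2) segre_rep_coord_space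
        proper_independent[OF T(1)] cardM'], goal_cases)
    case (1 F)
    from 1(2-) show thesis by (rule 1(1))
  qed
  obtain f where f: "multihomogeneous k n (bidegree 1 1) f"
    "\<And>J. J \<in> ?M \<Longrightarrow> Poly_Mapping.lookup f (multilinear_mon k J) = F J"
    using multilinear_form_exists[of k "bidegree 1 1" n F, OF d] by blast
  have eval: "mpoly_eval g (rep y) = pairing ?M (\<lambda>J. Poly_Mapping.lookup g (multilinear_mon k J)) (?t y)"
    if "multihomogeneous k n (bidegree 1 1) g" for g y
    using mpoly_eval_multilinear[OF that d] by (simp add: segre_rep_def)
  have eval_f: "mpoly_eval f (rep y) = pairing ?M F (?t y)" for y
    unfolding eval[OF f(1)] pairing_def by (intro sum.cong[OF refl]) (simp add: f(2))
  show thesis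
  proof (rule that[OF f(1)])
    show "f \<noteq> 0" using F(2) f(2) by fastforce
    show "mpoly_eval f (rep y) = 0" if "y \<in> S" for y
    proof (cases "y = z")
      case True
      have "0 = pairing ?M F (\<lambda>J. \<Sum>y\<in>S. c y * ?t y J)"
        by (simp add: relation pairing_def)
      also have "\<dots> = (\<Sum>y\<in>S. c y * pairing ?M F (?t y))" by (rule pairing_sum_right)
      also have "\<dots> = c z * pairing ?M F (?t z)"
        using z finite_S F(1) by (simp add: sum.remove[of S z] T_def)
      finally show ?thesis using True c_nonzero[OF z] eval_f by simp
    next
      case False
      then show ?thesis using that F(1)[of y] eval_f by (simp add: T_def)
    qed
    fix g assume g: "multihomogeneous k n (bidegree 1 1) g"
      and gS: "\<And>y. y \<in> S \<Longrightarrow> mpoly_eval g (rep y) = 0"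
    have "pairing ?M (\<lambda>J. Poly_Mapping.lookup g (multilinear_mon k J)) (?t y) = 0" if "y \<in> T" for y
      using eval[OF g, of y] gS[of y] T(1) that by auto
    then obtain r where r: "\<And>J. J \<in> ?M \<Longrightarrow> Poly_Mapping.lookup g (multilinear_mon k J) = r * F J"
      using F(3) by blast
    have "g = Poly_Mapping.single 0 r * f"
    proof (rule poly_mapping_eqI)
      fix m
      show "Poly_Mapping.lookup g m = Poly_Mapping.lookup (Poly_Mapping.single 0 r * f) m"
      proof (cases "m \<in> multilinear_mon k ` ?M")
        case True
        then show ?thesis using r f(2) by (auto simp: lookup_single_0_mult)
      next
        case False
        then have "m \<notin> Poly_Mapping.keys f" "m \<notin> Poly_Mapping.keys g"
          using multilinear_keys[OF f(1) d] multilinear_keys[OF g d] by blast+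
        then show ?thesis by (simp add: lookup_single_0_mult in_keys_iff)
      qed
    qed
    then show "\<exists>r. g = Poly_Mapping.single 0 r * f" by blast
  qed
qed

lemma S_sub_divisor_points_iff:
  assumes "multihomogeneous k n d f"
  shows "S \<subseteq> divisor_points k n (divisor_of f) \<longleftrightarrow> (\<forall>y\<in>S. mpoly_eval f (rep y) = 0)"
  using in_divisor_points_iff[OF assms] S_sub by blast

lemma unique_divisor:
  assumes k: "k = 2"
  shows "\<exists>!D. D \<in> linear_system k n (bidegree 1 1) \<and> S \<subseteq> divisor_points k n D"
proof -
  obtain f where f: "multihomogeneous k n (bidegree 1 1) f" "f \<noteq> 0"
    "\<And>y. y \<in> S \<Longrightarrow> mpoly_eval f (rep y) = 0"
    "\<And>g. multihomogeneous k n (bidegree 1 1) g \<Longrightarrow> (\<And>y. y \<in> S \<Longrightarrow> mpoly_eval g (rep y) = 0) \<Longrightarrow>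
      \<exists>r. g = Poly_Mapping.single 0 r * f"
  proof (rule bilinear_equation[OF k], goal_cases)
    case (1 f)
    from 1(2-) show thesis by (rule 1(1))
  qed
  show ?thesis
  proof (rule ex1I[of _ "divisor_of f"])
    show "divisor_of f \<in> linear_system k n (bidegree 1 1) \<and> S \<subseteq> divisor_points k n (divisor_of f)"
      unfolding S_sub_divisor_points_iff[OF f(1)] using f(1-3) by (auto simp: linear_system_def)
    fix D assume D: "D \<in> linear_system k n (bidegree 1 1) \<and> S \<subseteq> divisor_points k n D"
    then obtain g where g: "D = divisor_of g" "multihomogeneous k n (bidegree 1 1) g" "g \<noteq> 0"
      unfolding linear_system_def by blast
    then have "\<And>y. y \<in> S \<Longrightarrow> mpoly_eval g (rep y) = 0"
      using D S_sub_divisor_points_iff[OF g(2)] by blast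
    then obtain r where r: "g = Poly_Mapping.single 0 r * f" using f(4)[OF g(2)] by blast
    then have "r \<noteq> 0" using g(3) by auto
    then show "D = divisor_of f" unfolding g(1) r by (rule divisor_of_single_mult)
  qed
qed

text \<open>A factorization into nonunits is multihomogeneous, with multidegrees adding up to (1,1).
  A factor of multidegree (0,0) would be a unit, so the multidegrees are (1,0) and (0,1), in one
  order or the other.\<close>

lemma reducible_divisor_is_union:
  fixes D :: "'a mpoly set"
  assumes k: "k = 2" and D: "D \<in> linear_system k n (bidegree 1 1)" "\<not> irreducible_divisor D"
  shows "\<exists>D1\<in>linear_system k n (bidegree 1 0). \<exists>D2\<in>linear_system k n (bidegree 0 1).
    D = divisor_union D1 D2"
proof -
  have k12: "1 \<in> {1..k}" "2 \<in> {1..k}" and k_cases: "\<And>i. i \<in> {1..k} \<Longrightarrow> i = 1 \<or> i = 2" using k by auto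
  obtain f where f: "D = divisor_of f" "multihomogeneous k n (bidegree 1 1) f" "f \<noteq> 0"
    using D(1) unfolding linear_system_def by blast
  obtain g where g: "g \<in> D" "\<not> irreducible g" using D(2) unfolding irreducible_divisor_def by blast
  obtain r where r: "r \<noteq> 0" "g = Poly_Mapping.single 0 r * f"
    using g(1) unfolding f(1) by (rule divisor_ofE)
  have D_eq: "D = divisor_of g" unfolding f(1) r(2) using divisor_of_single_mult[OF r(1)] by simp
  have hom: "multihomogeneous k n (bidegree 1 1) g"
    unfolding r(2) using f(2) by (rule multihomogeneous_single_0_mult)
  have "Poly_Mapping.single 0 r \<noteq> (0 :: 'a mpoly)"
  proof
    assume "Poly_Mapping.single 0 r = (0 :: 'a mpoly)"
    then have "Poly_Mapping.lookup (Poly_Mapping.single 0 r :: 'a mpoly) 0 = 0" by simp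
    then show False using r(1) by simp
  qed
  then have "g \<noteq> 0" unfolding r(2) using f(3) by simp
  \<comment> \<open>A unit is not irreducible either; this possibility must be excluded before
    \<open>g\<close> can be split.\<close>
  have "\<not> g dvd 1"
    using multihomogeneous_dvd_1_imp_0[OF hom _ k12(1)] bidegree_factor(1)[of 1 1] by auto
  then obtain a b where ab: "g = a * b" "\<not> a dvd 1" "\<not> b dvd 1"
    using g(2) \<open>g \<noteq> 0\<close> unfolding irreducible_def by blast
  have ab0: "a \<noteq> 0" "b \<noteq> 0" using ab(1) \<open>g \<noteq> 0\<close> by auto
  have "multihomogeneous k n (bidegree 1 1) (a * b)" "a * b \<noteq> 0" using hom \<open>g \<noteq> 0\<close> ab(1) by auto
  then obtain p q where pq: "\<And>i. i \<in> {1..k} \<Longrightarrow> p i + q i = bidegree 1 1 i"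
    "multihomogeneous k n p a" "multihomogeneous k n q b"
    by (rule multihomogeneous_factors) blast
  have sums: "p 1 + q 1 = 1" "p 2 + q 2 = 1"
    using pq(1)[OF k12(1)] pq(1)[OF k12(2)] bidegree_factor(1,2)[of 1 1] by simp_all
  have "\<not> (p 1 = 0 \<and> p 2 = 0)" "\<not> (q 1 = 0 \<and> q 2 = 0)"
    using multihomogeneous_0_dvd_1[OF pq(2) ab0(1)] multihomogeneous_0_dvd_1[OF pq(3) ab0(2)] ab k_cases
    by metis+
  with sums consider "p 1 = 1" "p 2 = 0" "q 1 = 0" "q 2 = 1" | "p 1 = 0" "p 2 = 1" "q 1 = 1" "q 2 = 0"
    by linarith
  then obtain l m where lm: "multihomogeneous k n (bidegree 1 0) l" "l \<noteq> 0"
    "multihomogeneous k n (bidegree 0 1) m" "m \<noteq> 0" "g = l * m"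
  proof cases
    case 1
    have "multihomogeneous k n (bidegree 1 0) a" "multihomogeneous k n (bidegree 0 1) b"
      using pq(2,3) multihomogeneous_cong[of k p "bidegree 1 0" n a]
        multihomogeneous_cong[of k q "bidegree 0 1" n b] 1 k_cases bidegree_factor(1,2) by metis+
    then show thesis using that ab(1) ab0 by blast
  next
    case 2
    have "multihomogeneous k n (bidegree 1 0) b" "multihomogeneous k n (bidegree 0 1) a"
      using pq(2,3) multihomogeneous_cong[of k p "bidegree 0 1" n a]
        multihomogeneous_cong[of k q "bidegree 1 0" n b] 2 k_cases bidegree_factor(1,2) by metis+
    then show thesis using that[of b a] ab(1) ab0 by (simp add: mult.commute)
  qed
  have "D = divisor_union (divisor_of l) (divisor_of m)"
    unfolding D_eq lm(5) divisor_union_divisor_of ..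
  moreover have "divisor_of l \<in> linear_system k n (bidegree 1 0)"
    "divisor_of m \<in> linear_system k n (bidegree 0 1)"
    using lm unfolding linear_system_def by blast+
  ultimately show ?thesis by blast
qed

lemma secants_of_pair:
  assumes A: "A \<subseteq> S" "A = {a, b}" and ij: "i \<in> {1..k}" "j \<in> {1..k}" "i \<noteq> j" "a i \<noteq> b i" "a j \<noteq> b j"
  shows "\<exists>q. proj_span (segre k n ` A) \<inter> proj_span (segre k n ` (S - A)) = {q} \<and>
    X_rank k n q = 2 \<and> A \<in> rank_sets k n q \<and> S - A \<in> rank_sets k n q"
proof -
  have "a \<noteq> b" using ij by auto
  moreover have "{a, b} \<subseteq> S" using A by simp
  ultimately obtain d e where "S = {a, b, d, e}"
    using card_four_obtain_rest[OF card_S] by metis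
  then show ?thesis unfolding A(2) using card_S ij by (rule complementary_secants)
qed

text \<open>A divisor of bidegree (1,0) or (0,1) fixes the coordinate on one line, so it contains at
  most two of the four points. As the two divisors cover \<open>S\<close>, each contains exactly two
  and none is shared.\<close>

lemma reducible_case:
  assumes k: "k = 2" and D: "D1 \<in> linear_system k n (bidegree 1 0)" "D2 \<in> linear_system k n (bidegree 0 1)"
    and S_D: "S \<subseteq> divisor_points k n (divisor_union D1 D2)"
  shows "card (S \<inter> divisor_points k n D1) = 2 \<and> card (S \<inter> divisor_points k n D2) = 2 \<and>
    divisor_points k n D1 \<inter> divisor_points k n D2 \<inter> S = {} \<and>
    (\<forall>A \<subseteq> S. card (A \<inter> divisor_points k n D1) = 1 \<and> card (A \<inter> divisor_points k n D2) = 1 \<longrightarrow>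
      (\<exists>q. proj_span (segre k n ` A) \<inter> proj_span (segre k n ` (S - A)) = {q} \<and>
        X_rank k n q = 2 \<and> A \<in> rank_sets k n q \<and> S - A \<in> rank_sets k n q))"
proof -
  have k12: "1 \<in> {1..k}" "2 \<in> {1..k}" and k_cases: "\<And>i. i \<in> {1..k} \<Longrightarrow> i = 1 \<or> i = 2" using k by auto
  have n1: "n 1 = 1" "n 2 = 1" using number_of_factors k by auto
  obtain l where l: "D1 = divisor_of l" "multihomogeneous k n (bidegree 1 0) l" "l \<noteq> 0"
    using D(1) unfolding linear_system_def by blast
  obtain m where m: "D2 = divisor_of m" "multihomogeneous k n (bidegree 0 1) m" "m \<noteq> 0"
    using D(2) unfolding linear_system_def by blast
  let ?P1 = "divisor_points k n D1" and ?P2 = "divisor_points k n D2"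
  have P1: "y \<in> ?P1 \<longleftrightarrow> mpoly_eval l (rep y) = 0" and P2: "y \<in> ?P2 \<longleftrightarrow> mpoly_eval m (rep y) = 0"
    if "y \<in> S" for y
    unfolding l(1) m(1) using that S_sub
    by (intro in_divisor_points_iff[OF l(2)] in_divisor_points_iff[OF m(2)]; blast)+
  have "\<forall>y\<in>S. mpoly_eval (l * m) (rep y) = 0"
    using S_D unfolding l(1) m(1) divisor_union_divisor_of
      S_sub_divisor_points_iff[OF multihomogeneous_mult[OF l(2) m(2)]] .
  then have cover: "S = (S \<inter> ?P1) \<union> (S \<inter> ?P2)" using P1 P2 by (auto simp: mpoly_eval_mult)
  have zeros: "\<And>i. i \<in> {1..k} \<Longrightarrow> i \<noteq> 1 \<Longrightarrow> bidegree 1 0 i = 0"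
    "\<And>i. i \<in> {1..k} \<Longrightarrow> i \<noteq> 2 \<Longrightarrow> bidegree 0 1 i = 0"
    using k_cases bidegree_factor(1,2) by metis+
  have same1: "x 1 = y 1" if "x \<in> S" "x \<in> ?P1" "y \<in> S" "y \<in> ?P1" for x y
  proof (rule linear_form_one_point[OF l(2,3) k12(1) n1(1) bidegree_factor(1) zeros(1)])
    show "x \<in> multiproj k n" "y \<in> multiproj k n" using that S_sub by blast+
    show "mpoly_eval l (rep x) = 0" "mpoly_eval l (rep y) = 0" using that P1 by simp_all
  qed
  have same2: "x 2 = y 2" if "x \<in> S" "x \<in> ?P2" "y \<in> S" "y \<in> ?P2" for x y
  proof (rule linear_form_one_point[OF m(2,3) k12(2) n1(2) bidegree_factor(2) zeros(2)])
    show "x \<in> multiproj k n" "y \<in> multiproj k n" using that S_sub by blast+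
    show "mpoly_eval m (rep x) = 0" "mpoly_eval m (rep y) = 0" using that P2 by simp_all
  qed
  have le: "card (S \<inter> ?P1) \<le> 2" "card (S \<inter> ?P2) \<le> 2"
    by (rule equal_factor_card_le_2[OF k12(1)]; use same1 in simp)
      (rule equal_factor_card_le_2[OF k12(2)]; use same2 in simp)
  have fin: "finite (S \<inter> ?P1)" "finite (S \<inter> ?P2)" using finite_S by simp_all
  have "card S + card ((S \<inter> ?P1) \<inter> (S \<inter> ?P2)) = card (S \<inter> ?P1) + card (S \<inter> ?P2)"
    using card_Un_Int[OF fin] unfolding cover[symmetric] by (rule sym)
  then have cards: "card (S \<inter> ?P1) = 2" "card (S \<inter> ?P2) = 2" "card ((S \<inter> ?P1) \<inter> (S \<inter> ?P2)) = 0"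
    using le card_S by linarith+
  then have disj: "?P1 \<inter> ?P2 \<inter> S = {}" using finite_S by auto
  have "\<exists>q. proj_span (segre k n ` A) \<inter> proj_span (segre k n ` (S - A)) = {q} \<and>
      X_rank k n q = 2 \<and> A \<in> rank_sets k n q \<and> S - A \<in> rank_sets k n q"
    if A: "A \<subseteq> S" "card (A \<inter> ?P1) = 1" "card (A \<inter> ?P2) = 1" for A
  proof -
    obtain a where a: "A \<inter> ?P1 = {a}" using A(2) by (rule card_1_singletonE)
    obtain b where b: "A \<inter> ?P2 = {b}" using A(3) by (rule card_1_singletonE)
    have A_eq: "A = {a, b}" using a b A(1) cover by blast
    have in_S: "a \<in> S" "a \<in> ?P1" "a \<notin> ?P2" "b \<in> S" "b \<in> ?P2" "b \<notin> ?P1"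
      using a b A(1) disj by blast+
    \<comment> \<open>Otherwise \<open>b\<close> and the two points on \<open>D1\<close> would be
      three points with the same first coordinate.\<close>
    have "a 1 \<noteq> b 1"
    proof
      assume eq: "a 1 = b 1"
      have "x 1 = b 1" if "x \<in> insert b (S \<inter> ?P1)" for x
        using that same1[of x a] in_S eq by auto
      then have "card (insert b (S \<inter> ?P1)) \<le> 2"
        using in_S by (intro equal_factor_card_le_2[OF k12(1)]) auto
      then show False using cards(1) in_S finite_S by simp
    qed
    moreover have "a 2 \<noteq> b 2"
    proof
      assume eq: "a 2 = b 2"
      have "x 2 = a 2" if "x \<in> insert a (S \<inter> ?P2)" for x
        using that same2[of x b] in_S eq by auto
      then have "card (insert a (S \<inter> ?P2)) \<le> 2"
        using in_S by (intro equal_factor_card_le_2[OF k12(2)]) auto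
      then show False using cards(2) in_S finite_S by simp
    qed
    ultimately show ?thesis
      using secants_of_pair[OF A(1) A_eq k12] by simp
  qed
  with cards disj show ?thesis by blast
qed

text \<open>If \<open>x\<close> and \<open>y\<close> agree on \<open>i\<close>, the other two points
  agree on \<open>j\<close>. The product of the linear forms cutting out these two coordinates
  vanishes on \<open>S\<close>, so by uniqueness it is an equation of \<open>D\<close>, which is
  then reducible.\<close>

lemma irreducible_factors_distinct:
  assumes k: "k = 2" and D: "D \<in> linear_system k n (bidegree 1 1)" "S \<subseteq> divisor_points k n D"
    and irr: "irreducible_divisor D"
    and xy: "x \<in> S" "y \<in> S" "x \<noteq> y" and i: "i \<in> {1..k}"
  shows "x i \<noteq> y i"
proof
  assume eq: "x i = y i"
  \<comment> \<open>The other element of {1, 2}.\<close>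
  define j where "j = 3 - i"
  have "i = 1 \<or> i = 2" using i k by auto
  then have j: "j \<in> {1..k}" "i \<noteq> j" and ij: "\<And>l. l \<in> {1..k} \<Longrightarrow> l = i \<or> l = j"
    using k by (auto simp: j_def)
  have ni: "n i = 1" "n j = 1" using dim_factor[OF i j] dim_factor[OF j(1) i] j(2) by auto
  obtain a e where S: "S = {x, y, a, e}" "x \<noteq> a" "x \<noteq> e" "y \<noteq> a" "y \<noteq> e" "a \<noteq> e"
    using card_four_obtain_rest[OF card_S, of x y] xy by auto
  have opp: "a j = e j"
    using opposite_equal[of a x y e i j] S xy(3) i j eq by blast
  have mp: "x \<in> multiproj k n" "a \<in> multiproj k n" using S(1) S_sub by auto
  let ?di = "(\<lambda>_. 0 :: nat)(i := 1)" and ?dj = "(\<lambda>_. 0 :: nat)(j := 1)"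
  obtain l where l: "multihomogeneous k n ?di l" "l \<noteq> 0"
    "\<And>y. y \<in> multiproj k n \<Longrightarrow> y i = x i \<Longrightarrow> mpoly_eval l (rep y) = 0"
    by (rule linear_form_through_point[OF mp(1) i ni(1), of ?di]) auto
  obtain m where m: "multihomogeneous k n ?dj m" "m \<noteq> 0"
    "\<And>y. y \<in> multiproj k n \<Longrightarrow> y j = a j \<Longrightarrow> mpoly_eval m (rep y) = 0"
    by (rule linear_form_through_point[OF mp(2) j(1) ni(2), of ?dj]) auto
  have hom: "multihomogeneous k n (bidegree 1 1) (l * m)"
  proof -
    have "?di r + ?dj r = bidegree 1 1 r" if "r \<in> {1..k}" for r
      using ij[OF that] j(2) that bidegree_factor(3)[of r] k by auto
    then show ?thesis
      using multihomogeneous_mult[OF l(1) m(1)]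
        multihomogeneous_cong[of k "\<lambda>r. ?di r + ?dj r" "bidegree 1 1" n] by blast
  qed
  have "l * m \<noteq> 0" using l(2) m(2) by simp
  have "mpoly_eval (l * m) (rep z) = 0" if z: "z \<in> S" for z
  proof -
    have "z i = x i \<or> z j = a j" using z S(1) eq opp by auto
    then show ?thesis using l(3)[of z] m(3)[of z] z S_sub by (auto simp: mpoly_eval_mult)
  qed
  then have "S \<subseteq> divisor_points k n (divisor_of (l * m))"
    unfolding S_sub_divisor_points_iff[OF hom] by blast
  moreover have "divisor_of (l * m) \<in> linear_system k n (bidegree 1 1)"
    unfolding linear_system_def using hom \<open>l * m \<noteq> 0\<close> by blast
  ultimately have "D = divisor_of (l * m)" using unique_divisor[OF k] D by blast
  then have "irreducible (l * m)" using irr in_divisor_of_self unfolding irreducible_divisor_def by blast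
  then have "l dvd 1 \<or> m dvd 1" unfolding irreducible_def by blast
  then show False
    using multihomogeneous_dvd_1_imp_0[OF l(1) _ i] multihomogeneous_dvd_1_imp_0[OF m(1) _ j(1)] by auto
qed

end

theorem proposition5p2:
  fixes k :: nat
    and n :: "nat \<Rightarrow> nat"
    and S :: "(nat \<Rightarrow> (nat \<Rightarrow> 'a :: field) set) set"
  assumes n_pos: "\<forall>i\<in>{1..k}. n i > 0"
    and S_sub: "S \<subseteq> multiproj k n"
    and nondeg: "nondegenerate k n S"
    and circ: "circuit k n S"
    and card_S: "card S = 4"
  shows "(k = 1 \<and> n 1 = 2 \<or> k = 2 \<and> n 1 = 1 \<and> n 2 = 1) \<and>
    (k = 2 \<longrightarrow>
      (\<exists>!D. D \<in> linear_system k n (bidegree 1 1) \<and> S \<subseteq> divisor_points k n D) \<and>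
      (\<forall>D \<in> linear_system k n (bidegree 1 1). S \<subseteq> divisor_points k n D \<longrightarrow>
        (\<not> irreducible_divisor D \<longrightarrow>
          (\<exists>D1 \<in> linear_system k n (bidegree 1 0).
           \<exists>D2 \<in> linear_system k n (bidegree 0 1). D = divisor_union D1 D2) \<and>
          (\<forall>D1 \<in> linear_system k n (bidegree 1 0).
           \<forall>D2 \<in> linear_system k n (bidegree 0 1). D = divisor_union D1 D2 \<longrightarrow>
            card (S \<inter> divisor_points k n D1) = 2 \<and>
            card (S \<inter> divisor_points k n D2) = 2 \<and>
            divisor_points k n D1 \<inter> divisor_points k n D2 \<inter> S = {} \<and>
            (\<forall>A \<subseteq> S. card (A \<inter> divisor_points k n D1) = 1 \<and>
                     card (A \<inter> divisor_points k n D2) = 1 \<longrightarrow>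
              (\<exists>q. proj_span (segre k n ` A) \<inter> proj_span (segre k n ` (S - A)) = {q} \<and>
                   X_rank k n q = 2 \<and>
                   A \<in> rank_sets k n q \<and> S - A \<in> rank_sets k n q)))) \<and>
        (irreducible_divisor D \<longrightarrow>
          (\<forall>A \<subseteq> S. card A = 2 \<longrightarrow>
            (\<exists>q. proj_span (segre k n ` A) \<inter> proj_span (segre k n ` (S - A)) = {q} \<and>
                 X_rank k n q = 2 \<and>
                 A \<in> rank_sets k n q \<and> S - A \<in> rank_sets k n q)))))"
proof -
  have "finite S" using card_S card.infinite by fastforce
  moreover have "S \<noteq> {}" using card_S by auto
  ultimately obtain c where c: "segre_circuit k n S c"
    using segre_circuit_of_circuit[OF _ S_sub _ circ] by blast
  then interpret segre_circuit k n S c .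
  interpret nondegenerate_circuit k n S c
    using nondeg n_pos card_S by unfold_locales auto
  let ?secants = "\<lambda>A. \<exists>q. proj_span (segre k n ` A) \<inter> proj_span (segre k n ` (S - A)) = {q} \<and>
    X_rank k n q = 2 \<and> A \<in> rank_sets k n q \<and> S - A \<in> rank_sets k n q"
  \<comment> \<open>Any two points of \<open>S\<close> differ on both factors, so every pair can
    serve as the secant whose points have rank 2.\<close>
  have irreducible_case: "?secants A"
    if k: "k = 2" and D: "D \<in> linear_system k n (bidegree 1 1)" "S \<subseteq> divisor_points k n D"
      "irreducible_divisor D" and A: "A \<subseteq> S" "card A = 2" for D A
  proof -
    obtain a b where ab: "A = {a, b}" "a \<noteq> b" using A(2) unfolding card_2_iff by blast
    have k12: "1 \<in> {1..k}" "2 \<in> {1..k}" using k by auto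
    have "a \<in> S" "b \<in> S" using A(1) ab(1) by simp_all
    then have "a 1 \<noteq> b 1" "a 2 \<noteq> b 2"
      using irreducible_factors_distinct[OF k D _ _ ab(2)] k12 by blast+
    then show ?thesis using secants_of_pair[OF A(1) ab(1) k12] by simp
  qed
  show ?thesis
  proof (intro conjI impI ballI number_of_factors, goal_cases)
    case 1
    then show ?case by (rule unique_divisor)
  next
    case (2 D)
    then show ?case by (intro reducible_divisor_is_union)
  next
    case (3 D D1 D2)
    show ?case using reducible_case[OF 3(1,5,6) 3(3)[unfolded 3(7)]] by (elim conjE)
  next
    case (4 D D1 D2)
    show ?case using reducible_case[OF 4(1,5,6) 4(3)[unfolded 4(7)]] by (elim conjE)
  next
    case (5 D D1 D2)
    show ?case using reducible_case[OF 5(1,5,6) 5(3)[unfolded 5(7)]] by (elim conjE)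
  next
    case (6 D D1 D2)
    show ?case using reducible_case[OF 6(1,5,6) 6(3)[unfolded 6(7)]] by (elim conjE)
  next
    case (7 D)
    then show ?case using irreducible_case by blast
  qed
qed

end
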